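(* Let $(\mathcal{X},d,m,\mathcal{E},\mathcal{F})$ be a metric measure Dirichlet space of pure jump type as described in the context, satisfying (VD) and $\mathrm{Cap}(\phi)_\le$, and let $D\subset\mathcal{X}$ be an Ahlfors regular open set with $\overline D\subsetneq\mathcal{X}$. Let $\mathfrak{E}$ be the extension operator defined in the context. Then there is $C>0$ such that for every $u\in L^2(\overline D;m_0)$, $x_0\in\overline D$ and $r>0$, $$\int_{B(x_0,r)}|\mathfrak{E}u(x)|^2\,m(dx)\le C\int_{B(x_0,7r)\cap D}u(x)^2\,m_0(dx).$$ In particular, $\mathfrak{E}$ is a bounded linear extension operator from $L^2(\overline D;m_0)$ to $L^2(\mathcal{X};m)$ with $$\int_{\mathcal{X}}|\mathfrak{E}u(x)|^2\,m(dx)\le C\int_Du(x)^2\,m_0(dx).$$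
   Context: Setting. $(\mathcal{X},d)$ is a locally compact separable metric space and $m$ is a Radon measure on $\mathcal{X}$ with full support (atoms are allowed). $B(x,r)=\{y:d(x,y)<r\}$, $V(x,r)=m(B(x,r))$. $(\mathcal{E},\mathcal{F})$ is a symmetric regular Dirichlet form on $L^2(\mathcal{X};m)$ with $J(dx,dy)=J(x,y)m(dx)m(dy)$, $$\mathcal{F}=\Big\{u\in L^2(\mathcal{X};m):\int_{\mathcal{X}\times\mathcal{X}}(u(x)-u(y))^2J(dx,dy)<\infty\Big\},\quad \mathcal{E}(u,v)=\tfrac12\int_{\mathcal{X}\times\mathcal{X}}(u(x)-u(y))(v(x)-v(y))J(dx,dy).$$ Functions in $\mathcal F$ are represented by $\mathcal E$-quasi-continuous versions. $\phi:[0,\infty)\to[0,\infty)$ is strictly increasing with $\phi(0)=0$, $\phi(1)=1$, and there are $c_1,c_2>0$, $\beta_2\ge\beta_1>0$ with $c_1(R/r)^{\beta_1}\le\phi(R)/\phi(r)\le c_2(R/r)^{\beta_2}$ for all $0<r\le R<\infty$. (VD): there is $C_1\in(1,\infty)$ with $V(x,2r)\le C_1V(x,r)$ for all $x\in\mathcal{X}$, $r>0$. $\mathrm{Cap}(\phi)_\le$: with $\mathrm{Cap}(A,B)=\inf\{\mathcal{E}(f,f):f\in\mathcal{F},f|_A=1,f|_{\mathcal{X}\setminus B}=0\}$, there is $c>0$ such that $\mathrm{Cap}(B(x,r),B(x,2r))\le c\,m(B(x,r))/\phi(r)$ for every $x\in\mathcal{X}$ and $0<r<\operatorname{diam}(\mathcal{X})/3$.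 Ahlfors regular: there is $c_D\in(0,1]$ with $m(B(x,r)\cap D)\ge c_D\,m(B(x,r))$ for every $x\in D$ and $0<r<\operatorname{diam}(D)/2$, where $\operatorname{diam}(D)=\sup_{x,y\in D}d(x,y)$. $m_0(A)=m(A\cap D)$ for Borel $A\subset\overline D$. Whitney cover. Fix a $\frac14$-Whitney cover of $\mathcal{X}\setminus\overline D$, i.e. balls $B_i=B(x_i,r_i)$, $i\in I$, with $x_i\in\mathcal{X}\setminus\overline D$, $r_i>0$, such that the $B_i$ are pairwise disjoint, $d(x_i,\overline D)=5r_i$, and $\bigcup_{i\in I}\frac52B_i=\mathcal{X}\setminus\overline D$, where $\lambda B_i:=B(x_i,\lambda r_i)$. Let $\Lambda=\{i\in I:0<r_i<\operatorname{diam}(D)/2\}$. Functions $f_i$. Fix a collection $\{f_i:i\in\Lambda\}\subset L^2(\mathcal{X};m)$ with: (D.1) $0\le f_i\le1$ and $\sum_{i\in\Lambda}f_i\le\mathbf{1}_D$ $m$-a.e.; (D.2) $\operatorname{diam}(\operatorname{supp}[f_i])\le2r_i$; (D.3) $d(x_i,\operatorname{supp}[f_i])\le7r_i$; (D.4) there is $C>1$ with $C^{-1}m(B_i)\le\int_Df_i\,dm\le C\,m(B_i)$ for all $i\in\Lambda$. (Such a collection exists under (VD) and Ahlfors regularity. $\operatorname{supp}[f]$ is the smallest closed set off which $f=0$ $m$-a.e.) Functions $\psi_i$. For $i\in I$ let $\eta_i\in\mathcal{F}$ satisfy $0\le\eta_i\le1$, $\eta_i=1$ on $\frac52B_i$,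 $\eta_i=0$ on $\mathcal{X}\setminus3B_i$, $\mathcal{E}(\eta_i,\eta_i)\le C\,m(B_i)/\phi(r_i)$ with $C$ independent of $i$ (such $\eta_i$ exist under (VD) and $\mathrm{Cap}(\phi)_\le$). Put $\psi_i=\eta_i/\sum_{j\in I}\eta_j$ on $\mathcal{X}\setminus\overline D$ and $\psi_i=0$ on $\overline D$. Extension operator. For $u\in L^2(\overline D;m_0)$, $\mathfrak{E}u=u$ on $\overline D$ and $\mathfrak{E}u(x)=\sum_{i\in\Lambda}[u]_i\psi_i(x)$ for $x\in\mathcal{X}\setminus\overline D$, where $[u]_i=\int_Df_iu\,dm\big/\int_Df_i\,dm$. *)

theory Defs
  imports "HOL-Analysis.Analysis"
begin

text \<open>The library's \<^const>\<open>diameter\<close> is real-valued and meaningless for unbounded sets.\<close>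

definition ediam :: "'a::metric_space set \<Rightarrow> ennreal" where
  "ediam S = (SUP x\<in>S. SUP y\<in>S. ennreal (dist x y))"

definition radon_measure :: "'a::topological_space measure \<Rightarrow> bool" where
  "radon_measure m \<longleftrightarrow>
     sets m = sets borel
   \<and> (\<forall>K. compact K \<longrightarrow> emeasure m K < \<infinity>)
   \<and> (\<forall>A\<in>sets borel. emeasure m A = (INF U\<in>{U. open U \<and> A \<subseteq> U}. emeasure m U))
   \<and> (\<forall>U. open U \<longrightarrow> emeasure m U = (SUP K\<in>{K. compact K \<and> K \<subseteq> U}. emeasure m K))"

definition full_support :: "'a::topological_space measure \<Rightarrow> bool" where
  "full_support m \<longleftrightarrow> (\<forall>U. open U \<and> U \<noteq> {} \<longrightarrow> 0 < emeasure m U)"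

definition volume_doubling :: "'a::metric_space measure \<Rightarrow> bool" where
  "volume_doubling m \<longleftrightarrow>
     (\<exists>C>1. \<forall>x. \<forall>r>0. emeasure m (ball x (2 * r)) \<le> ennreal C * emeasure m (ball x r))"

definition scale_function :: "(real \<Rightarrow> real) \<Rightarrow> bool" where
  "scale_function \<phi> \<longleftrightarrow>
     \<phi> \<in> {0..} \<rightarrow> {0..} \<and> strict_mono_on {0..} \<phi> \<and> \<phi> 0 = 0 \<and> \<phi> 1 = 1
   \<and> (\<exists>c1 c2 \<beta>1 \<beta>2. 0 < c1 \<and> 0 < c2 \<and> 0 < \<beta>1 \<and> \<beta>1 \<le> \<beta>2
        \<and> (\<forall>r R. 0 < r \<and> r \<le> R \<longrightarrow>
             c1 * (R / r) powr \<beta>1 \<le> \<phi> R / \<phi> r \<and> \<phi> R / \<phi> r \<le> c2 * (R / r) powr \<beta>2))"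

definition ahlfors_regular :: "'a::metric_space measure \<Rightarrow> 'a set \<Rightarrow> bool" where
  "ahlfors_regular m D \<longleftrightarrow>
     (\<exists>c. 0 < c \<and> c \<le> 1
        \<and> (\<forall>x\<in>D. \<forall>r>0. ennreal r < ediam D / 2 \<longrightarrow>
              ennreal c * emeasure m (ball x r) \<le> emeasure m (ball x r \<inter> D)))"

definition ess_support :: "'a::topological_space measure \<Rightarrow> ('a \<Rightarrow> real) \<Rightarrow> 'a set" where
  "ess_support m f = \<Inter>{S. closed S \<and> (AE x in m. x \<notin> S \<longrightarrow> f x = 0)}"

text \<open>Elements of \<open>L\<^sup>2\<close> are represented by functions; identification up to null sets is made
  explicit where it matters.\<close>

definition L2 :: "'a measure \<Rightarrow> ('a \<Rightarrow> real) set" where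
  "L2 M = {u \<in> borel_measurable M. integrable M (\<lambda>x. (u x)\<^sup>2)}"

definition L2_linear_operator ::
  "'a measure \<Rightarrow> 'b measure \<Rightarrow> (('a \<Rightarrow> real) \<Rightarrow> 'b \<Rightarrow> real) \<Rightarrow> bool" where
  "L2_linear_operator M N T \<longleftrightarrow>
     (\<forall>u\<in>L2 M. T u \<in> L2 N)
   \<and> (\<forall>u\<in>L2 M. \<forall>v\<in>L2 M. (AE x in M. u x = v x) \<longrightarrow> (AE x in N. T u x = T v x))
   \<and> (\<forall>u\<in>L2 M. \<forall>v\<in>L2 M. \<forall>a b. AE x in N. T (\<lambda>y. a * u y + b * v y) x = a * T u x + b * T v x)"

definition form1 :: "'a measure \<Rightarrow> (('a \<Rightarrow> real) \<Rightarrow> ('a \<Rightarrow> real) \<Rightarrow> real) \<Rightarrow> ('a \<Rightarrow> real) \<Rightarrow> real" where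
  "form1 m \<E> u = \<E> u u + (\<integral>x. (u x)\<^sup>2 \<partial>m)"

text \<open>The clauses are, in order: the domain is a linear space of \<open>L\<^sup>2\<close> classes, the form is
  well defined on classes, bilinear, symmetric and nonnegative, densely defined, closed, and
  Markovian.\<close>

definition symmetric_dirichlet_form ::
  "'a measure \<Rightarrow> (('a \<Rightarrow> real) \<Rightarrow> ('a \<Rightarrow> real) \<Rightarrow> real) \<Rightarrow> ('a \<Rightarrow> real) set \<Rightarrow> bool" where
  "symmetric_dirichlet_form m \<E> \<F> \<longleftrightarrow>
     \<F> \<subseteq> L2 m
   \<and> (\<forall>u\<in>\<F>. \<forall>v\<in>L2 m. (AE x in m. u x = v x) \<longrightarrow> v \<in> \<F>)
   \<and> (\<forall>u\<in>\<F>. \<forall>v\<in>\<F>. \<forall>a b. (\<lambda>x. a * u x + b * v x) \<in> \<F>)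
   \<and> (\<forall>u\<in>\<F>. \<forall>v\<in>\<F>. \<forall>w\<in>\<F>. (AE x in m. u x = v x) \<longrightarrow> \<E> u w = \<E> v w)
   \<and> (\<forall>u\<in>\<F>. \<forall>v\<in>\<F>. \<forall>w\<in>\<F>. \<forall>a b. \<E> (\<lambda>x. a * u x + b * v x) w = a * \<E> u w + b * \<E> v w)
   \<and> (\<forall>u\<in>\<F>. \<forall>v\<in>\<F>. \<E> u v = \<E> v u)
   \<and> (\<forall>u\<in>\<F>. 0 \<le> \<E> u u)
   \<and> (\<forall>u\<in>L2 m. \<forall>\<epsilon>>0. \<exists>v\<in>\<F>. (\<integral>x. (u x - v x)\<^sup>2 \<partial>m) < \<epsilon>)
   \<and> (\<forall>w. (\<forall>n::nat. w n \<in> \<F>)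
          \<and> (\<forall>\<epsilon>>0. \<exists>N. \<forall>n\<ge>N. \<forall>k\<ge>N. form1 m \<E> (\<lambda>x. w n x - w k x) < \<epsilon>)
        \<longrightarrow> (\<exists>u\<in>\<F>. (\<lambda>n. form1 m \<E> (\<lambda>x. w n x - u x)) \<longlonglongrightarrow> 0))
   \<and> (\<forall>u\<in>\<F>. (\<lambda>x. min (max (u x) 0) 1) \<in> \<F>
          \<and> \<E> (\<lambda>x. min (max (u x) 0) 1) (\<lambda>x. min (max (u x) 0) 1) \<le> \<E> u u)"

definition Cc :: "('a::topological_space \<Rightarrow> real) set" where
  "Cc = {f. continuous_on UNIV f \<and> compact (closure {x. f x \<noteq> 0})}"

definition regular_dirichlet_form ::
  "'a::topological_space measure \<Rightarrow> (('a \<Rightarrow> real) \<Rightarrow> ('a \<Rightarrow> real) \<Rightarrow> real) \<Rightarrow> ('a \<Rightarrow> real) set \<Rightarrow> bool"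
where
  "regular_dirichlet_form m \<E> \<F> \<longleftrightarrow>
     symmetric_dirichlet_form m \<E> \<F>
   \<and> (\<forall>u\<in>\<F>. \<forall>\<epsilon>>0. \<exists>v\<in>\<F> \<inter> Cc. form1 m \<E> (\<lambda>x. u x - v x) < \<epsilon>)
   \<and> (\<forall>u\<in>Cc. \<forall>\<epsilon>>0. \<exists>v\<in>\<F> \<inter> Cc. \<forall>x. \<bar>u x - v x\<bar> < \<epsilon>)"

text \<open>The jump measure \<open>J(dx,dy) = J(x,y) m(dx) m(dy)\<close>; infinite values of the kernel (as on
  the diagonal) are allowed.\<close>

definition jump_measure :: "'a measure \<Rightarrow> ('a \<Rightarrow> 'a \<Rightarrow> ennreal) \<Rightarrow> ('a \<times> 'a) measure" where
  "jump_measure m J = density (m \<Otimes>\<^sub>M m) (\<lambda>(x, y). J x y)"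

definition jump_domain :: "'a measure \<Rightarrow> ('a \<Rightarrow> 'a \<Rightarrow> ennreal) \<Rightarrow> ('a \<Rightarrow> real) set" where
  "jump_domain m J = {u \<in> L2 m. (\<integral>\<^sup>+(x, y). ennreal ((u x - u y)\<^sup>2) \<partial>jump_measure m J) < \<infinity>}"

definition jump_form ::
  "'a measure \<Rightarrow> ('a \<Rightarrow> 'a \<Rightarrow> ennreal) \<Rightarrow> ('a \<Rightarrow> real) \<Rightarrow> ('a \<Rightarrow> real) \<Rightarrow> real" where
  "jump_form m J u v = (1/2) * (\<integral>(x, y). (u x - u y) * (v x - v y) \<partial>jump_measure m J)"

text \<open>Used for open \<open>G\<close> only, so no infimum over open supersets is needed.\<close>

definition cap1 ::
  "'a measure \<Rightarrow> (('a \<Rightarrow> real) \<Rightarrow> ('a \<Rightarrow> real) \<Rightarrow> real) \<Rightarrow> ('a \<Rightarrow> real) set \<Rightarrow> 'a set \<Rightarrow> ennreal" where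
  "cap1 m \<E> \<F> G = (INF f\<in>{f \<in> \<F>. AE x in m. x \<in> G \<longrightarrow> 1 \<le> f x}. ennreal (form1 m \<E> f))"

definition quasi_continuous ::
  "'a::topological_space measure \<Rightarrow> (('a \<Rightarrow> real) \<Rightarrow> ('a \<Rightarrow> real) \<Rightarrow> real) \<Rightarrow> ('a \<Rightarrow> real) set
    \<Rightarrow> ('a \<Rightarrow> real) \<Rightarrow> bool" where
  "quasi_continuous m \<E> \<F> f \<longleftrightarrow>
     (\<forall>\<epsilon>>0. \<exists>G. open G \<and> cap1 m \<E> \<F> G < ennreal \<epsilon> \<and> continuous_on (- G) f)"

text \<open>Any function that agrees quasi-everywhere with a quasi-continuous one is quasi-continuous,
  so imposing the boundary values pointwise on some quasi-continuous version is the same as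
  imposing them quasi-everywhere.\<close>

definition rel_cap ::
  "'a::topological_space measure \<Rightarrow> (('a \<Rightarrow> real) \<Rightarrow> ('a \<Rightarrow> real) \<Rightarrow> real) \<Rightarrow> ('a \<Rightarrow> real) set
    \<Rightarrow> 'a set \<Rightarrow> 'a set \<Rightarrow> ennreal" where
  "rel_cap m \<E> \<F> A B =
     (INF f\<in>{f \<in> \<F>. quasi_continuous m \<E> \<F> f \<and> (\<forall>x\<in>A. f x = 1) \<and> (\<forall>x\<in>- B. f x = 0)}.
        ennreal (\<E> f f))"

definition cap_upper ::
  "'a::metric_space measure \<Rightarrow> (('a \<Rightarrow> real) \<Rightarrow> ('a \<Rightarrow> real) \<Rightarrow> real) \<Rightarrow> ('a \<Rightarrow> real) set
    \<Rightarrow> (real \<Rightarrow> real) \<Rightarrow> bool" where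
  "cap_upper m \<E> \<F> \<phi> \<longleftrightarrow>
     (\<exists>c>0. \<forall>x. \<forall>r>0. ennreal r < ediam (UNIV :: 'a set) / 3 \<longrightarrow>
        rel_cap m \<E> \<F> (ball x r) (ball x (2 * r)) \<le> ennreal c * emeasure m (ball x r) / ennreal (\<phi> r))"

text \<open>\<open>m\<^sub>0 A = m (A \<inter> D)\<close> for Borel subsets \<open>A\<close> of the closure of \<open>D\<close>.\<close>

definition m0 :: "'a::topological_space measure \<Rightarrow> 'a set \<Rightarrow> 'a measure" where
  "m0 m D = restrict_space (density m (indicator D)) (closure D)"

definition whitney_cover ::
  "'a::metric_space set \<Rightarrow> 'i set \<Rightarrow> ('i \<Rightarrow> 'a) \<Rightarrow> ('i \<Rightarrow> real) \<Rightarrow> bool" where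
  "whitney_cover D I p \<rho> \<longleftrightarrow>
     (\<forall>i\<in>I. p i \<notin> closure D \<and> 0 < \<rho> i \<and> infdist (p i) (closure D) = 5 * \<rho> i)
   \<and> disjoint_family_on (\<lambda>i. ball (p i) (\<rho> i)) I
   \<and> (\<Union>i\<in>I. ball (p i) (5/2 * \<rho> i)) = - closure D"

definition small_indices :: "'a::metric_space set \<Rightarrow> 'i set \<Rightarrow> ('i \<Rightarrow> real) \<Rightarrow> 'i set" where
  "small_indices D I \<rho> = {i\<in>I. 0 < \<rho> i \<and> ennreal (\<rho> i) < ediam D / 2}"

text \<open>The sum of the \<open>f i\<close> is taken in \<^typ>\<open>ennreal\<close>, where it always exists.\<close>

definition averaging_family ::
  "'a::metric_space measure \<Rightarrow> 'a set \<Rightarrow> 'i set \<Rightarrow> ('i \<Rightarrow> 'a) \<Rightarrow> ('i \<Rightarrow> real)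
    \<Rightarrow> ('i \<Rightarrow> 'a \<Rightarrow> real) \<Rightarrow> bool" where
  "averaging_family m D \<Lambda> p \<rho> f \<longleftrightarrow>
     (\<forall>i\<in>\<Lambda>. f i \<in> L2 m)
   \<and> (\<forall>i\<in>\<Lambda>. AE x in m. 0 \<le> f i x \<and> f i x \<le> 1)
   \<and> (AE x in m. (\<Sum>\<^sub>\<infinity>i\<in>\<Lambda>. ennreal (f i x)) \<le> indicator D x)
   \<and> (\<forall>i\<in>\<Lambda>. ediam (ess_support m (f i)) \<le> ennreal (2 * \<rho> i))
   \<and> (\<forall>i\<in>\<Lambda>. infdist (p i) (ess_support m (f i)) \<le> 7 * \<rho> i)
   \<and> (\<exists>C>1. \<forall>i\<in>\<Lambda>. measure m (ball (p i) (\<rho> i)) / C \<le> (LINT x:D|m. f i x)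
                   \<and> (LINT x:D|m. f i x) \<le> C * measure m (ball (p i) (\<rho> i)))"

definition cutoff_family ::
  "'a::metric_space measure \<Rightarrow> (('a \<Rightarrow> real) \<Rightarrow> ('a \<Rightarrow> real) \<Rightarrow> real) \<Rightarrow> ('a \<Rightarrow> real) set
    \<Rightarrow> (real \<Rightarrow> real) \<Rightarrow> 'i set \<Rightarrow> ('i \<Rightarrow> 'a) \<Rightarrow> ('i \<Rightarrow> real) \<Rightarrow> ('i \<Rightarrow> 'a \<Rightarrow> real) \<Rightarrow> bool" where
  "cutoff_family m \<E> \<F> \<phi> I p \<rho> \<eta> \<longleftrightarrow>
     (\<forall>i\<in>I. \<eta> i \<in> \<F> \<and> quasi_continuous m \<E> \<F> (\<eta> i)
        \<and> (\<forall>x. 0 \<le> \<eta> i x \<and> \<eta> i x \<le> 1)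
        \<and> (\<forall>x\<in>ball (p i) (5/2 * \<rho> i). \<eta> i x = 1)
        \<and> (\<forall>x\<in>- ball (p i) (3 * \<rho> i). \<eta> i x = 0))
   \<and> (\<exists>C>0. \<forall>i\<in>I. \<E> (\<eta> i) (\<eta> i) \<le> C * measure m (ball (p i) (\<rho> i)) / \<phi> (\<rho> i))"

definition partition_fun ::
  "'a::topological_space set \<Rightarrow> 'i set \<Rightarrow> ('i \<Rightarrow> 'a \<Rightarrow> real) \<Rightarrow> 'i \<Rightarrow> 'a \<Rightarrow> real" where
  "partition_fun D I \<eta> i x = (if x \<in> closure D then 0 else \<eta> i x / (\<Sum>\<^sub>\<infinity>j\<in>I. \<eta> j x))"

definition weighted_mean :: "'a measure \<Rightarrow> 'a set \<Rightarrow> ('a \<Rightarrow> real) \<Rightarrow> ('a \<Rightarrow> real) \<Rightarrow> real" where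
  "weighted_mean m D g u = (LINT x:D|m. g x * u x) / (LINT x:D|m. g x)"

text \<open>Only finitely many terms of the sum over \<open>\<Lambda>\<close> (and of the one in \<^const>\<open>partition_fun\<close>)
  are nonzero at any given point, by volume doubling and the Whitney property.\<close>

definition extension_operator ::
  "'a::topological_space measure \<Rightarrow> 'a set \<Rightarrow> 'i set \<Rightarrow> ('i \<Rightarrow> 'a \<Rightarrow> real) \<Rightarrow> ('i \<Rightarrow> 'a \<Rightarrow> real)
    \<Rightarrow> ('a \<Rightarrow> real) \<Rightarrow> 'a \<Rightarrow> real" where
  "extension_operator m D \<Lambda> f \<psi> u x =
     (if x \<in> closure D then u x else (\<Sum>\<^sub>\<infinity>i\<in>\<Lambda>. weighted_mean m D (f i) u * \<psi> i x))"

end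

theory Submission
  imports Defs
begin

text \<open>The extension is pointwise a sub-convex combination of averages, so by Jensen its square is at
  most \<open>\<Sum>i\<in>\<Lambda>. [u]\<^sub>i\<^sup>2 \<psi>\<^sub>i\<close> off the closure of \<open>D\<close>. Cauchy--Schwarz, the normalisation of \<open>f\<^sub>i\<close> and
  doubling give \<open>[u]\<^sub>i\<^sup>2 m(3B\<^sub>i) \<le> K \<integral> f\<^sub>i u\<^sup>2\<close>, and \<open>\<Sum> f\<^sub>i \<le> 1\<close> sums these bounds. Locality: if
  \<open>3B\<^sub>i\<close> meets \<open>B(x\<^sub>0, r)\<close> with \<open>x\<^sub>0\<close> in the closure of \<open>D\<close>, then \<open>5r\<^sub>i < 3r\<^sub>i + r\<close>, so the support
  of \<open>f\<^sub>i\<close> lies in the ball of radius \<open>12r\<^sub>i + r < 7r\<close>. On the closure of \<open>D\<close> only \<open>D\<close> matters,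
  because the boundary of an Ahlfors regular open set is null.\<close>

section \<open>Countable sums as integrals and weighted inequalities\<close>

text \<open>Enumerating \<open>A\<close> turns the integral into a series whose partial sums are
  finite subsums, each below the supremum that gives the unordered sum. The integral form makes the
  hypothesis on \<Sum> f_i accessible to Tonelli.\<close>

lemma nn_integral_count_space_le_infsum:
  fixes g :: "'i \<Rightarrow> ennreal"
  assumes A: "countable A"
  shows "(\<integral>\<^sup>+i. g i \<partial>count_space A) \<le> (\<Sum>\<^sub>\<infinity>i\<in>A. g i)"
proof -
  let ?e = "to_nat_on A" and ?d = "from_nat_into A"
  \<comment> \<open>The indicator pads the enumeration with zeros, so that finite and infinite
    \<open>A\<close> are treated alike.\<close>
  let ?h = "\<lambda>n. g (?d n) * indicator (?e ` A) n"
  have "(\<integral>\<^sup>+i. g i \<partial>count_space A) = (\<integral>\<^sup>+i. g (?d (?e i)) \<partial>count_space A)"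
    using A by (intro nn_integral_cong) simp
  also have "\<dots> = (\<integral>\<^sup>+n. g (?d n) \<partial>count_space (?e ` A))"
    by (rule nn_integral_bij_count_space) (simp add: A inj_on_to_nat_on inj_on_imp_bij_betw)
  also have "\<dots> = (\<Sum>n. ?h n)"
    by (subst nn_integral_count_space_indicator) (auto simp: nn_integral_count_space_nat)
  also have "\<dots> = (SUP N. sum ?h {..<N})"
    by (rule suminf_eq_SUP)
  also have "\<dots> \<le> (\<Sum>\<^sub>\<infinity>i\<in>A. g i)"
  proof (rule SUP_least)
    fix N
    let ?F = "?d ` ({..<N} \<inter> ?e ` A)"
    have inj: "inj_on ?d ({..<N} \<inter> ?e ` A)"
      by (rule inj_onI) (use A in auto)
    have "sum ?h {..<N} = sum (\<lambda>n. g (?d n)) ({..<N} \<inter> ?e ` A)"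
      by (rule sum.mono_neutral_cong_right) (auto simp: indicator_def)
    also have "\<dots> = sum g ?F"
      using inj by (simp add: sum.reindex)
    also have "\<dots> \<le> (SUP F\<in>{F. finite F \<and> F \<subseteq> A}. sum g F)"
      by (rule SUP_upper) (use A in auto)
    also have "\<dots> = (\<Sum>\<^sub>\<infinity>i\<in>A. g i)"
      by (simp add: nonneg_infsum_complete)
    finally show "sum ?h {..<N} \<le> (\<Sum>\<^sub>\<infinity>i\<in>A. g i)" .
  qed
  finally show ?thesis .
qed

text \<open>For reals, summability is absolute summability, that is, integrability for counting
  measure; when it fails, both sides take the default value 0.\<close>

lemma infsum_eq_lebesgue_integral:
  fixes g :: "'i \<Rightarrow> real"
  shows "infsum g A = (\<integral>i. g i \<partial>count_space A)"
proof (cases "integrable (count_space A) g")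
  case True
  then show ?thesis
    by (metis abs_summable_on_def infsetsum_def infsetsum_infsum)
next
  case False
  then have "\<not> g summable_on A"
    by (metis abs_summable_equivalent abs_summable_on_def summable_on_iff_abs_summable_on_real)
  with False show ?thesis
    by (simp add: infsum_not_exists not_integrable_integral_eq)
qed

text \<open>Over a countable discrete factor, joint measurability reduces to measurability of each
  section; swapping the factors puts the discrete one second.\<close>

lemma measurable_case_prod_count_space:
  assumes A: "countable A" and g: "\<And>i. i \<in> A \<Longrightarrow> g i \<in> measurable M N"
  shows "(\<lambda>(x, i). g i x) \<in> measurable (M \<Otimes>\<^sub>M count_space A) N"
proof -
  have "(\<lambda>z. g (fst z) (snd z)) \<in> measurable (count_space A \<Otimes>\<^sub>M M) N"
    using A g by (intro measurable_pair_measure_countable1) simp_all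
  then show ?thesis
    by (subst measurable_pair_swap_iff) (simp add: case_prod_beta)
qed

text \<open>Where summability fails, the sum has the same default value as the integral, so
  measurability of parametrised integrals over a sigma-finite counting measure covers every
  point.\<close>

lemma borel_measurable_infsum_real:
  fixes g :: "'i \<Rightarrow> 'a \<Rightarrow> real"
  assumes A: "countable A" and g: "\<And>i. i \<in> A \<Longrightarrow> g i \<in> borel_measurable M"
  shows "(\<lambda>x. \<Sum>\<^sub>\<infinity>i\<in>A. g i x) \<in> borel_measurable M"
proof -
  interpret sigma_finite_measure "count_space A"
    using A by (rule sigma_finite_measure_count_space_countable)
  show ?thesis
    unfolding infsum_eq_lebesgue_integral
    using measurable_case_prod_count_space[OF A g] by (rule borel_measurable_lebesgue_integral)
qed

lemma borel_measurable_nn_integral_count_space: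
  fixes g :: "'i \<Rightarrow> 'a \<Rightarrow> ennreal"
  assumes A: "countable A" and g: "\<And>i. i \<in> A \<Longrightarrow> g i \<in> borel_measurable M"
  shows "(\<lambda>x. \<integral>\<^sup>+i. g i x \<partial>count_space A) \<in> borel_measurable M"
proof -
  interpret sigma_finite_measure "count_space A"
    using A by (rule sigma_finite_measure_count_space_countable)
  show ?thesis
    using measurable_case_prod_count_space[OF A g] by (rule borel_measurable_nn_integral)
qed

section \<open>Weighted Cauchy--Schwarz and Jensen inequalities\<close>

lemma weighted_Cauchy_Schwarz:
  fixes w g :: "'a \<Rightarrow> real"
  assumes w: "integrable M w" and wg: "integrable M (\<lambda>x. w x * g x)"
    and wgg: "integrable M (\<lambda>x. w x * (g x)\<^sup>2)" and nn: "AE x in M. 0 \<le> w x"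
  shows "(\<integral>x. w x * g x \<partial>M)\<^sup>2 \<le> (\<integral>x. w x \<partial>M) * (\<integral>x. w x * (g x)\<^sup>2 \<partial>M)"
proof -
  define W where "W = (\<integral>x. w x \<partial>M)"
  define s where "s = (\<integral>x. w x * g x \<partial>M)"
  define Q where "Q = (\<integral>x. w x * (g x)\<^sup>2 \<partial>M)"
  have W0: "0 \<le> W" unfolding W_def using nn by (rule integral_nonneg_AE)
  \<comment> \<open>Scaling the deviation from the mean by \<open>W\<close> avoids a division; the
    expansion gives W (W Q - s^2) \<ge> 0.\<close>
  have "0 \<le> (\<integral>x. w x * (W * g x - s)\<^sup>2 \<partial>M)"
    by (rule integral_nonneg_AE) (use nn in auto)
  also have "(\<lambda>x. w x * (W * g x - s)\<^sup>2) =
      (\<lambda>x. W\<^sup>2 * (w x * (g x)\<^sup>2) - 2 * W * s * (w x * g x) + s\<^sup>2 * w x)"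
    by (auto simp: fun_eq_iff power2_eq_square algebra_simps)
  also have "(\<integral>x. W\<^sup>2 * (w x * (g x)\<^sup>2) - 2 * W * s * (w x * g x) + s\<^sup>2 * w x \<partial>M) =
      W\<^sup>2 * Q - 2 * W * s * s + s\<^sup>2 * W"
    using assms by (simp add: W_def s_def Q_def)
  finally have *: "0 \<le> W * (W * Q - s\<^sup>2)"
    by (simp add: power2_eq_square algebra_simps)
  show ?thesis
  \<comment> \<open>The factor \<open>W\<close> cannot be cancelled when it is 0, but then
    \<open>w\<close> vanishes almost everywhere and so \<open>s\<close> is 0.\<close>
  proof (cases "W = 0")
    case True
    then have "AE x in M. w x = 0"
      using integral_nonneg_eq_0_iff_AE[OF w nn] by (simp add: W_def)
    then have "AE x in M. w x * g x = 0" by auto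
    then have "s = 0" unfolding s_def by (simp add: integral_eq_zero_AE)
    with True show ?thesis by (simp flip: W_def s_def)
  next
    case False
    with W0 * have "0 \<le> W * Q - s\<^sup>2" by (simp add: zero_le_mult_iff)
    then show ?thesis by (simp flip: W_def s_def Q_def)
  qed
qed

text \<open>Since |a| \<le> 1 + a^2, the product is dominated by \<open>w + w g^2\<close>, a sum of
  two integrable functions.\<close>

lemma integrable_weighted_of_square:
  fixes w g :: "'a \<Rightarrow> real"
  assumes [measurable]: "w \<in> borel_measurable M" "g \<in> borel_measurable M"
    and w: "integrable M w" and wgg: "integrable M (\<lambda>x. w x * (g x)\<^sup>2)" and nn: "AE x in M. 0 \<le> w x"
  shows "integrable M (\<lambda>x. w x * g x)"
proof (rule Bochner_Integration.integrable_bound)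
  show "integrable M (\<lambda>x. w x + w x * (g x)\<^sup>2)"
    using w wgg by (rule Bochner_Integration.integrable_add)
  have *: "\<bar>a\<bar> \<le> 1 + a\<^sup>2" for a :: real
    using zero_le_power2[of "\<bar>a\<bar> - 1"] by (simp add: power2_eq_square algebra_simps)
  show "AE x in M. norm (w x * g x) \<le> norm (w x + w x * (g x)\<^sup>2)"
    using nn
  proof eventually_elim
    case (elim x)
    then have "w x * \<bar>g x\<bar> \<le> w x * (1 + (g x)\<^sup>2)"
      by (intro mult_left_mono *)
    with elim show ?case by (simp add: abs_mult algebra_simps)
  qed
qed simp

text \<open>Cauchy--Schwarz with total mass at most 1 lets the mass factor be dropped. With values
  in \<open>ennreal\<close> the divergent case is trivial, and in the other case all three
  integrands are integrable.\<close>

lemma subprobability_Jensen_square: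
  fixes w g :: "'a \<Rightarrow> real"
  assumes [measurable]: "w \<in> borel_measurable M" "g \<in> borel_measurable M"
    and nn: "\<And>x. x \<in> space M \<Longrightarrow> 0 \<le> w x" and le1: "(\<integral>\<^sup>+x. ennreal (w x) \<partial>M) \<le> 1"
  shows "ennreal ((\<integral>x. w x * g x \<partial>M)\<^sup>2) \<le> (\<integral>\<^sup>+x. ennreal (w x * (g x)\<^sup>2) \<partial>M)"
proof (cases "(\<integral>\<^sup>+x. ennreal (w x * (g x)\<^sup>2) \<partial>M) = \<infinity>")
  case False
  have w: "integrable M w"
    using le1 by (intro integrableI_nonneg) (auto simp: nn intro: le_less_trans)
  have wgg: "integrable M (\<lambda>x. w x * (g x)\<^sup>2)"
    using False by (intro integrableI_nonneg) (auto simp: nn less_top)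
  have "ennreal (\<integral>x. w x \<partial>M) \<le> 1"
    using le1 w by (subst nn_integral_eq_integral[symmetric]) (auto simp: nn)
  then have "(\<integral>x. w x \<partial>M) \<le> 1" by simp
  moreover have "0 \<le> (\<integral>x. w x * (g x)\<^sup>2 \<partial>M)"
    by (rule integral_nonneg_AE) (auto simp: nn)
  ultimately have "(\<integral>x. w x \<partial>M) * (\<integral>x. w x * (g x)\<^sup>2 \<partial>M) \<le> (\<integral>x. w x * (g x)\<^sup>2 \<partial>M)"
    by (rule mult_left_le_one_le[rotated 2]) (auto intro!: integral_nonneg_AE simp: nn)
  moreover have "(\<integral>x. w x * g x \<partial>M)\<^sup>2 \<le> (\<integral>x. w x \<partial>M) * (\<integral>x. w x * (g x)\<^sup>2 \<partial>M)"
    by (rule weighted_Cauchy_Schwarz[OF w integrable_weighted_of_square[OF assms(1,2) w wgg] wgg])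
       (simp_all add: nn)
  ultimately have "(\<integral>x. w x * g x \<partial>M)\<^sup>2 \<le> (\<integral>x. w x * (g x)\<^sup>2 \<partial>M)" by linarith
  then show ?thesis
    using nn_integral_eq_integral[OF wgg] by (simp add: nn ennreal_leI)
qed simp

section \<open>Doubling Radon measures and Ahlfors regular sets\<close>

text \<open>Balls need not be relatively compact, so finiteness on compact sets does not settle this
  directly. Local compactness gives one small ball of finite measure, and repeated doubling carries
  finiteness to every radius.\<close>

lemma emeasure_ball_finite:
  fixes m :: "'a::metric_space measure"
  assumes lc: "locally_compact_space (euclidean :: 'a topology)"
    and m: "radon_measure m" and vd: "volume_doubling m"
  shows "emeasure m (ball x r) < \<infinity>"
proof -
  have sm: "sets m = sets borel" using m by (simp add: radon_measure_def)
  obtain U K where "open U" "compact K" "x \<in> U" "U \<subseteq> K"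
    using lc unfolding locally_compact_space_def
    by (metis UNIV_I compactin_euclidean_iff open_openin topspace_euclidean)
  then obtain e where e: "e > 0" "ball x e \<subseteq> K"
    by (metis open_contains_ball_eq subset_trans)
  obtain C where C: "C > 1" "\<And>y s. s > 0 \<Longrightarrow> emeasure m (ball y (2 * s)) \<le> ennreal C * emeasure m (ball y s)"
    using vd unfolding volume_doubling_def by blast
  have fin: "emeasure m (ball x (2 ^ n * e)) < \<infinity>" for n
  proof (induction n)
    case 0
    have "emeasure m (ball x e) \<le> emeasure m K"
      using e \<open>compact K\<close> by (intro emeasure_mono) (auto simp: sm borel_compact)
    also have "\<dots> < \<infinity>" using m \<open>compact K\<close> by (simp add: radon_measure_def)
    finally show ?case by simp
  next
    case (Suc n)
    have "emeasure m (ball x (2 * (2 ^ n * e))) \<le> ennreal C * emeasure m (ball x (2 ^ n * e))"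
      using e by (intro C) simp
    also have "\<dots> < \<infinity>" using Suc by (simp add: ennreal_mult_less_top)
    finally show ?case by (simp add: mult.assoc)
  qed
  obtain n where "r / e < 2 ^ n" using real_arch_pow[of 2 "r / e"] by auto
  then have "ball x r \<subseteq> ball x (2 ^ n * e)" using e by (auto simp: field_simps)
  then have "emeasure m (ball x r) \<le> emeasure m (ball x (2 ^ n * e))"
    by (intro emeasure_mono) (auto simp: sm)
  with fin[of n] show ?thesis by (rule le_less_trans[rotated])
qed

text \<open>The complement of the support may be an uncountable union of open sets on each of which
  \<open>g\<close> vanishes almost everywhere; by Lindelof countably many of them suffice.\<close>

lemma AE_zero_off_ess_support:
  fixes m :: "'a::second_countable_topology measure"
  shows "AE x in m. x \<notin> ess_support m g \<longrightarrow> g x = 0"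
proof -
  let ?\<S> = "{S. closed S \<and> (AE x in m. x \<notin> S \<longrightarrow> g x = 0)}"
  obtain \<U> where \<U>: "\<U> \<subseteq> uminus ` ?\<S>" "countable \<U>" "\<Union>\<U> = \<Union>(uminus ` ?\<S>)"
    by (rule Lindelof[of "uminus ` ?\<S>"]) auto
  have "AE x in m. \<forall>U\<in>\<U>. x \<in> U \<longrightarrow> g x = 0"
    using \<U>(1,2) by (subst AE_ball_countable) auto
  then show ?thesis
  proof eventually_elim
    case (elim x)
    have "- ess_support m g = \<Union>\<U>"
      unfolding \<U>(3) ess_support_def by auto
    with elim show ?case by blast
  qed
qed

lemma dist_le_of_ediam:
  assumes "ediam S \<le> ennreal d" "x \<in> S" "y \<in> S" "0 \<le> d"
  shows "dist x y \<le> d"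
proof -
  have "ennreal (dist x y) \<le> ediam S"
    unfolding ediam_def using assms(2,3) by (intro SUP_upper2[of x] SUP_upper2[of y]) auto
  also note assms(1)
  finally show ?thesis using assms(4) by simp
qed

text \<open>The distance to \<open>S\<close> need not be attained. A point \<open>y\<close> outside
  the ball leaves a strict gap, which admits a near-minimiser \<open>z\<close>; then
  \<open>dist z y\<close> \<le> \<open>d\<close> contradicts the triangle inequality.\<close>

lemma subset_cball_of_infdist_ediam:
  assumes "ediam S \<le> ennreal d" "infdist x S \<le> e" "0 \<le> d"
  shows "S \<subseteq> cball x (e + d)"
proof
  fix y assume y: "y \<in> S"
  show "y \<in> cball x (e + d)"
  proof (rule ccontr)
    assume "y \<notin> cball x (e + d)"
    then have "infdist x S < dist x y - d" using assms(2) by simp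
    then obtain z where z: "z \<in> S" "dist x z < dist x y - d"
      using y by (metis empty_iff cINF_less_iff bdd_below_image_dist infdist_notempty)
    have "dist x y \<le> dist x z + dist z y" by (rule dist_triangle)
    also have "dist z y \<le> d" using assms z y by (intro dist_le_of_ediam)
    finally show False using z by simp
  qed
qed

text \<open>A Vitali selection with a single radius: compactness gives finitely many centres, and
  among these a maximal set with disjoint balls is chosen.\<close>

lemma compact_disjoint_balls_cover:
  fixes K :: "'a::metric_space set"
  assumes K: "compact K" and r: "r > 0"
  obtains S where "finite S" "S \<subseteq> K" "disjoint_family_on (\<lambda>s. ball s r) S"
    "K \<subseteq> (\<Union>s\<in>S. ball s (4 * r))"
proof -
  have "K \<subseteq> (\<Union>x\<in>K. ball x r)" using r by auto
  then obtain T where T: "T \<subseteq> K" "finite T" "K \<subseteq> (\<Union>x\<in>T. ball x r)"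
    by (rule compactE_image[OF K open_ball])
  define \<S> where "\<S> = {S. S \<subseteq> T \<and> disjoint_family_on (\<lambda>s. ball s r) S}"
  have "finite \<S>" using T(2) by (simp add: \<S>_def)
  moreover have "{} \<in> \<S>" by (simp add: \<S>_def disjoint_family_on_def)
  ultimately obtain S where "S \<in> \<S>" and Smax: "\<And>S'. S' \<in> \<S> \<Longrightarrow> S \<subseteq> S' \<Longrightarrow> S = S'"
    using finite_has_maximal[of \<S>] by (metis empty_iff)
  then have S: "S \<subseteq> T" "disjoint_family_on (\<lambda>s. ball s r) S" by (auto simp: \<S>_def)
  have "K \<subseteq> (\<Union>s\<in>S. ball s (4 * r))"
  proof
    fix k assume "k \<in> K"
    then obtain a where a: "a \<in> T" "dist a k < r" using T(3) by auto
    show "k \<in> (\<Union>s\<in>S. ball s (4 * r))"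
    proof (cases "a \<in> S")
      case True
      moreover have "k \<in> ball a (4 * r)" using a r by simp
      ultimately show ?thesis by blast
    next
      case False
      \<comment> \<open>By maximality a rejected ball meets a selected one. The path from
        \<open>s\<close> to \<open>k\<close> then has three legs shorter than \<open>r\<close>; the
        radius \<open>4 * r\<close> exceeds 3r and amounts to two doublings.\<close>
      have "\<exists>s\<in>S. ball a r \<inter> ball s r \<noteq> {}"
      proof (rule ccontr)
        assume "\<not> ?thesis"
        then have "disjoint_family_on (\<lambda>s. ball s r) (insert a S)"
          using S(2) False by (auto simp: disjoint_family_on_insert)
        then have "insert a S \<in> \<S>"
          using S(1) a(1) by (simp add: \<S>_def)
        then show False using Smax[of "insert a S"] False by blast
      qed
      then obtain s b where sb: "s \<in> S" "dist a b < r" "dist s b < r" by auto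
      have "dist s k \<le> dist s b + dist a b + dist a k"
        using dist_triangle[of s k b] dist_triangle[of b k a] by (simp add: dist_commute)
      then have "k \<in> ball s (4 * r)" using sb a(2) r by simp
      with sb(1) show ?thesis by blast
    qed
  qed
  moreover have "finite S" "S \<subseteq> K" "disjoint_family_on (\<lambda>s. ball s r) S"
    using S T(1,2) finite_subset by auto
  ultimately show ?thesis using that by blast
qed

text \<open>Near a boundary point \<open>D\<close> occupies a fixed fraction of every small ball. Cover a compact
  piece of the boundary by enlarged balls of one small radius whose originals are disjoint and lie
  in an open set of nearly the same measure: the mass of \<open>D\<close> in these balls dominates the mass of
  the piece but is contained in the small excess.\<close>

lemma ahlfors_regular_boundary_null:
  fixes m :: "'a::{metric_space, second_countable_topology} measure"
  assumes lc: "locally_compact_space (euclidean :: 'a topology)"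
    and m: "radon_measure m" and vd: "volume_doubling m"
    and D: "open D" and ahl: "ahlfors_regular m D"
  shows "closure D - D \<in> null_sets m"
proof -
  have sm: "sets m = sets borel" using m by (simp add: radon_measure_def)
  let ?F = "closure D - D"
  have cF: "closed ?F" using D by (simp add: closed_Diff)
  obtain C where C: "C > 1" "\<And>y s. s > 0 \<Longrightarrow> emeasure m (ball y (2 * s)) \<le> ennreal C * emeasure m (ball y s)"
    using vd unfolding volume_doubling_def by blast
  obtain c where c: "c > 0" "\<And>x r. x \<in> D \<Longrightarrow> r > 0 \<Longrightarrow> ennreal r < ediam D / 2 \<Longrightarrow>
      ennreal c * emeasure m (ball x r) \<le> emeasure m (ball x r \<inter> D)"
    using ahl unfolding ahlfors_regular_def by blast
  have C2: "emeasure m (ball y (2 * (2 * s))) \<le> ennreal (C\<^sup>2) * emeasure m (ball y s)" if "s > 0" for y s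
  proof -
    have "emeasure m (ball y (2 * (2 * s))) \<le> ennreal C * emeasure m (ball y (2 * s))"
      using that by (intro C) simp
    also have "\<dots> \<le> ennreal C * (ennreal C * emeasure m (ball y s))"
      using that by (intro mult_left_mono C) simp_all
    also have "\<dots> = ennreal (C\<^sup>2) * emeasure m (ball y s)"
      using C(1) by (simp add: power2_eq_square ennreal_mult mult.assoc)
    finally show ?thesis .
  qed
  \<comment> \<open>The Ahlfors bound is given at points of \<open>D\<close>, so \<open>x\<close> is
    replaced by some \<open>y\<close> in \<open>D\<close> within r/2. Then B(x,4r) lies in B(y,8r),
    four doublings lead down to B(y,r/2), and this lies in B(x,r).\<close>
  have density: "ennreal c * emeasure m (ball x (4 * r)) \<le> ennreal (C ^ 4) * emeasure m (ball x r \<inter> D)"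
    if x: "x \<in> ?F" and r: "r > 0" "ennreal (r / 2) < ediam D / 2" for x r
  proof -
    obtain y where y: "y \<in> D" "dist y x < r / 2"
      using x r by (metis Diff_iff closure_approachable half_gt_zero)
    have "ball x (2 * (2 * r)) \<subseteq> ball y (2 * (2 * (2 * r)))"
    proof
      fix z assume "z \<in> ball x (2 * (2 * r))"
      with y(2) r(1) dist_triangle[of y z x] show "z \<in> ball y (2 * (2 * (2 * r)))" by simp
    qed
    then have "emeasure m (ball x (4 * r)) \<le> emeasure m (ball y (2 * (2 * (2 * (2 * (r / 2))))))"
      by (intro emeasure_mono) (simp_all add: sm)
    also have "\<dots> \<le> ennreal (C\<^sup>2) * emeasure m (ball y (2 * (2 * (r / 2))))"
      using r by (intro C2) simp
    also have "\<dots> \<le> ennreal (C\<^sup>2) * (ennreal (C\<^sup>2) * emeasure m (ball y (r / 2)))"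
      using r by (intro mult_left_mono C2) simp_all
    also have "\<dots> = ennreal (C ^ 4) * emeasure m (ball y (r / 2))"
      using C(1) by (simp add: mult.assoc[symmetric] ennreal_mult[symmetric] power_add[symmetric])
    finally have "ennreal c * emeasure m (ball x (4 * r)) \<le> ennreal c * (ennreal (C ^ 4) * emeasure m (ball y (r / 2)))"
      by (rule mult_left_mono) simp
    also have "\<dots> = ennreal (C ^ 4) * (ennreal c * emeasure m (ball y (r / 2)))"
      by (simp add: mult_ac)
    also have "\<dots> \<le> ennreal (C ^ 4) * emeasure m (ball y (r / 2) \<inter> D)"
      using y r by (intro mult_left_mono c) simp_all
    also have "\<dots> \<le> ennreal (C ^ 4) * emeasure m (ball x r \<inter> D)"
    proof (intro mult_left_mono emeasure_mono)
      show "ball y (r / 2) \<inter> D \<subseteq> ball x r \<inter> D"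
      proof
        fix z assume "z \<in> ball y (r / 2) \<inter> D"
        with y(2) dist_triangle[of x z y] show "z \<in> ball x r \<inter> D"
          by (simp add: dist_commute)
      qed
    qed (use D in \<open>simp_all add: sm\<close>)
    finally show ?thesis .
  qed
  have null_compact: "emeasure m K = 0" if K: "compact K" "K \<subseteq> ?F" for K
  proof (cases "K = {}")
    case False
    then obtain x where x: "x \<in> ?F" using K(2) by blast
    then obtain y where y: "y \<in> D" "dist y x < 1"
      by (metis Diff_iff closure_approachable zero_less_one)
    \<comment> \<open>A boundary point outside \<open>D\<close> forces two distinct points
      \<open>y\<close>, \<open>z\<close> in \<open>D\<close>. Their distance \<open>t\<close> bounds
      the diameter from below and so leaves admissible radii for the Ahlfors condition.\<close>
    have "dist y x > 0" using x y by auto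
    then obtain z where z: "z \<in> D" "dist z x < dist y x"
      using x by (metis Diff_iff closure_approachable)
    define t where "t = dist y z"
    have t: "t > 0" "ennreal t \<le> ediam D"
      unfolding t_def ediam_def using y z by (auto intro: SUP_upper2[OF y(1) SUP_upper2[OF z(1)]])
    have Kb: "K \<in> sets borel" using K by (simp add: borel_compact)
    have finK: "emeasure m K < \<infinity>" using m K by (simp add: radon_measure_def)
    have bound: "ennreal c * emeasure m K \<le> ennreal (C ^ 4) * ennreal e" if e: "e > 0" for e
    proof -
      have "emeasure m K = (INF U\<in>{U. open U \<and> K \<subseteq> U}. emeasure m U)"
        using m Kb by (simp add: radon_measure_def)
      moreover have "emeasure m K < emeasure m K + ennreal e"
        using finK e by (cases "emeasure m K") (auto simp: ennreal_plus[symmetric] intro: ennreal_lessI simp del: ennreal_plus)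
      ultimately obtain U where U: "open U" "K \<subseteq> U" "emeasure m U < emeasure m K + ennreal e"
        by (metis (mono_tags, lifting) INF_less_iff mem_Collect_eq)
      obtain d where d: "d > 0" "(\<Union>x\<in>K. ball x d) \<subseteq> U"
        using compact_subset_open_imp_ball_epsilon_subset[OF K(1) U(1,2)] .
      \<comment> \<open>Being below \<open>d\<close> keeps the balls inside \<open>U\<close>; the
        bound by \<open>t\<close> makes r/2 admissible in the Ahlfors condition.\<close>
      define r where "r = min d t / 2"
      have r: "r > 0" "r < d" using d t by (auto simp: r_def)
      have "ennreal (r / 2) < ennreal (t / 2)"
        using d t by (intro ennreal_lessI) (auto simp: r_def)
      also have "ennreal (t / 2) = ennreal t / 2"
        using t by (simp add: divide_ennreal[symmetric])
      also have "\<dots> \<le> ediam D / 2"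
        using t(2) by (rule divide_right_mono_ennreal)
      finally have r2: "ennreal (r / 2) < ediam D / 2" .
      obtain S where S: "finite S" "S \<subseteq> K" "disjoint_family_on (\<lambda>s. ball s r) S"
          "K \<subseteq> (\<Union>s\<in>S. ball s (4 * r))"
        using compact_disjoint_balls_cover[OF K(1) r(1)] .
      have "ennreal c * emeasure m K \<le> ennreal c * (\<Sum>s\<in>S. emeasure m (ball s (4 * r)))"
      proof (rule mult_left_mono)
        have "emeasure m K \<le> emeasure m (\<Union>s\<in>S. ball s (4 * r))"
          using S(4) by (intro emeasure_mono) (auto simp: sm intro!: borel_open)
        also have "\<dots> \<le> (\<Sum>s\<in>S. emeasure m (ball s (4 * r)))"
          using S(1) by (intro emeasure_subadditive_finite) (auto simp: sm)
        finally show "emeasure m K \<le> (\<Sum>s\<in>S. emeasure m (ball s (4 * r)))" .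
      qed simp
      also have "\<dots> = (\<Sum>s\<in>S. ennreal c * emeasure m (ball s (4 * r)))"
        by (simp add: sum_distrib_left)
      also have "\<dots> \<le> (\<Sum>s\<in>S. ennreal (C ^ 4) * emeasure m (ball s r \<inter> D))"
        using S(2) K(2) r r2 by (intro sum_mono density) auto
      also have "\<dots> = ennreal (C ^ 4) * (\<Sum>s\<in>S. emeasure m (ball s r \<inter> D))"
        by (simp add: sum_distrib_left)
      also have "(\<Sum>s\<in>S. emeasure m (ball s r \<inter> D)) = emeasure m (\<Union>s\<in>S. ball s r \<inter> D)"
      proof (rule sum_emeasure)
        show "disjoint_family_on (\<lambda>s. ball s r \<inter> D) S"
          using S(3) unfolding disjoint_family_on_def by blast
      qed (use S(1) D in \<open>auto simp: sm\<close>)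
      \<comment> \<open>\<open>K\<close> is disjoint from \<open>D\<close>, so the part of
        \<open>D\<close> in these balls lies in the excess of \<open>U\<close> over
        \<open>K\<close>.\<close>
      also have "\<dots> \<le> emeasure m (U - K)"
      proof (rule emeasure_mono)
        have "ball s r \<subseteq> U" if "s \<in> S" for s
          using that S(2) d(2) r(2) by fastforce
        then show "(\<Union>s\<in>S. ball s r \<inter> D) \<subseteq> U - K" using K(2) by blast
      qed (use U Kb in \<open>auto simp: sm\<close>)
      also have "emeasure m (U - K) = emeasure m U - emeasure m K"
        using finK U Kb by (intro emeasure_Diff) (auto simp: sm)
      also have "\<dots> \<le> ennreal e"
        using U(3) finK by (auto simp: ennreal_minus_le_iff less_imp_le)
      finally show ?thesis by (simp add: mult_left_mono)
    qed
    show ?thesis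
    proof (rule ccontr)
      assume "emeasure m K \<noteq> 0"
      define M where "M = measure m K"
      have M: "emeasure m K = ennreal M" "M > 0"
        using finK \<open>emeasure m K \<noteq> 0\<close> by (auto simp: M_def emeasure_eq_ennreal_measure zero_less_measure_iff)
      \<comment> \<open>With this choice the bound reads cM \<le> cM/2.\<close>
      let ?e = "c * M / (2 * C ^ 4)"
      have "?e > 0" using c(1) C(1) M by simp
      from bound[OF this] have "c * M \<le> C ^ 4 * ?e"
        using c(1) C(1) M by (simp add: ennreal_mult[symmetric])
      then show False using c(1) C(1) M by simp
    qed
  qed simp
  \<comment> \<open>Local compactness and Lindelof cover the space by countably many open sets with
    compact hulls; each cuts from the boundary a subset of a compact piece.\<close>
  let ?\<U> = "{U :: 'a set. open U \<and> (\<exists>K. compact K \<and> U \<subseteq> K)}"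
  obtain \<U> where \<U>: "\<U> \<subseteq> ?\<U>" "countable \<U>" "\<Union>\<U> = \<Union>?\<U>"
    by (rule Lindelof[of ?\<U>]) auto
  have "\<Union>?\<U> = UNIV"
    using lc unfolding locally_compact_space_def by (simp add: set_eq_iff) metis
  with \<U> have "?F = (\<Union>U\<in>\<U>. ?F \<inter> U)" by auto
  moreover have "?F \<inter> U \<in> null_sets m" if U: "U \<in> \<U>" for U
  proof -
    obtain K where K: "compact K" "U \<subseteq> K" "open U" using subsetD[OF \<U>(1) U] by auto
    then have "compact (?F \<inter> K)" using cF by (simp add: closed_Int_compact)
    then have "?F \<inter> K \<in> null_sets m"
      by (intro null_setsI null_compact) (auto simp: sm borel_compact)
    then show ?thesis
      by (rule null_sets_subset) (use K cF in \<open>auto simp: sm\<close>)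
  qed
  ultimately show ?thesis using \<U>(2) by (metis null_sets_UN')
qed

section \<open>The Whitney extension operator\<close>

locale whitney_extension =
  fixes m :: "'a::{metric_space, second_countable_topology} measure"
    and D :: "'a set" and I \<Lambda> :: "'i set" and p :: "'i \<Rightarrow> 'a" and \<rho> :: "'i \<Rightarrow> real"
    and f \<eta> :: "'i \<Rightarrow> 'a \<Rightarrow> real"
  assumes locally_compact: "locally_compact_space (euclidean :: 'a topology)"
    and radon: "radon_measure m" and doubling: "volume_doubling m"
    and open_D: "open D" and regular_D: "ahlfors_regular m D"
    and whitney: "whitney_cover D I p \<rho>" and \<Lambda>_subset: "\<Lambda> \<subseteq> I"
    and averaging: "averaging_family m D \<Lambda> p \<rho> f"
    and \<eta>_measurable: "\<And>i. i \<in> I \<Longrightarrow> \<eta> i \<in> borel_measurable m"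
    and \<eta>_nonneg: "\<And>i x. i \<in> I \<Longrightarrow> 0 \<le> \<eta> i x"
    and \<eta>_support: "\<And>i x. i \<in> I \<Longrightarrow> x \<notin> ball (p i) (3 * \<rho> i) \<Longrightarrow> \<eta> i x = 0"
begin

abbreviation "\<psi> \<equiv> partition_fun D I \<eta>"
abbreviation "mean i u \<equiv> weighted_mean m D (f i) u"
abbreviation "Ext \<equiv> extension_operator m D \<Lambda> f \<psi>"

text \<open>A function in \<open>L2 (m0 m D)\<close> is controlled on the closure of
  \<open>D\<close> only and its values off \<open>D\<close> carry no mass. The truncation is
  \<open>m\<close>-measurable on the whole space and turns integrals against \<open>m0\<close> into
  integrals against \<open>m\<close>.\<close>

definition cut :: "('a \<Rightarrow> real) \<Rightarrow> 'a \<Rightarrow> real" where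
  "cut u x = indicator D x * u x"

lemma sets_m [simp, measurable_cong]: "sets m = sets borel"
  using radon by (simp add: radon_measure_def)

lemma space_m [simp]: "space m = UNIV"
  using sets_eq_imp_space_eq[OF sets_m] by simp

lemma D_borel [measurable]: "D \<in> sets borel"
  using open_D by simp

lemma boundary_AE: "AE x in m. x \<in> closure D \<longrightarrow> x \<in> D"
  using AE_not_in[OF ahlfors_regular_boundary_null[OF locally_compact radon doubling open_D regular_D]]
  by eventually_elim auto

lemma radius_pos: "i \<in> I \<Longrightarrow> 0 < \<rho> i"
  using whitney by (simp add: whitney_cover_def)

text \<open>Disjoint open sets in a second countable space form a countable family; as each ball
  contains its centre, distinct indices give distinct balls.\<close>

lemma countable_I: "countable I"
proof -
  have disj: "disjoint_family_on (\<lambda>i. ball (p i) (\<rho> i)) I"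
    using whitney by (simp add: whitney_cover_def)
  have ne: "p i \<in> ball (p i) (\<rho> i)" if "i \<in> I" for i
    using radius_pos[OF that] by simp
  have "inj_on (\<lambda>i. ball (p i) (\<rho> i)) I"
  proof (rule inj_onI, rule ccontr)
    fix i j assume "i \<in> I" "j \<in> I" "ball (p i) (\<rho> i) = ball (p j) (\<rho> j)" "i \<noteq> j"
    then show False
      using disjoint_family_onD[OF disj, of i j] ne[of i] by blast
  qed
  moreover have "pairwise disjnt ((\<lambda>i. ball (p i) (\<rho> i)) ` I)"
    using disjoint_family_onD[OF disj] by (intro pairwise_imageI) (simp add: disjnt_def)
  then have "countable ((\<lambda>i. ball (p i) (\<rho> i)) ` I)"
    by (rule countable_disjoint_open_subsets[rotated]) auto
  ultimately show ?thesis using countable_image_inj_on by blast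
qed

lemma countable_\<Lambda>: "countable \<Lambda>"
  using countable_I \<Lambda>_subset countable_subset by blast

lemma f_measurable [measurable]: "i \<in> \<Lambda> \<Longrightarrow> f i \<in> borel_measurable borel"
  using averaging by (simp add: averaging_family_def L2_def cong: measurable_cong_sets)

lemma f_bounds: "i \<in> \<Lambda> \<Longrightarrow> AE x in m. 0 \<le> f i x \<and> f i x \<le> 1"
  using averaging by (simp add: averaging_family_def)

text \<open>The radius 9 is 7 + 2: the bound on the distance to the support plus the bound on its
  diameter.\<close>

lemma f_support:
  assumes i: "i \<in> \<Lambda>"
  shows "AE x in m. x \<notin> cball (p i) (9 * \<rho> i) \<longrightarrow> f i x = 0"
proof -
  have "ess_support m (f i) \<subseteq> cball (p i) (7 * \<rho> i + 2 * \<rho> i)"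
    using averaging i radius_pos[of i] \<Lambda>_subset
    by (intro subset_cball_of_infdist_ediam) (auto simp: averaging_family_def less_imp_le)
  then have sub: "ess_support m (f i) \<subseteq> cball (p i) (9 * \<rho> i)" by simp
  show ?thesis
    using AE_zero_off_ess_support[of m "f i"] by eventually_elim (use sub in blast)
qed

lemma sum_f_le_1: "AE x in m. (\<integral>\<^sup>+i. ennreal (f i x) \<partial>count_space \<Lambda>) \<le> 1"
proof -
  have "AE x in m. (\<Sum>\<^sub>\<infinity>i\<in>\<Lambda>. ennreal (f i x)) \<le> indicator D x"
    using averaging by (simp add: averaging_family_def)
  then show ?thesis
  proof eventually_elim
    case (elim x)
    have "(\<integral>\<^sup>+i. ennreal (f i x) \<partial>count_space \<Lambda>) \<le> (\<Sum>\<^sub>\<infinity>i\<in>\<Lambda>. ennreal (f i x))"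
      using countable_\<Lambda> by (rule nn_integral_count_space_le_infsum)
    also note elim
    also have "indicator D x \<le> (1 :: ennreal)" by (simp add: indicator_def)
    finally show ?case .
  qed
qed

section \<open>The partition functions\<close>

lemma partition_measurable [measurable]:
  assumes "i \<in> I"
  shows "\<psi> i \<in> borel_measurable borel"
proof -
  have \<eta>: "\<eta> j \<in> borel_measurable borel" if "j \<in> I" for j
    using \<eta>_measurable[OF that] by (simp cong: measurable_cong_sets)
  have [measurable]: "(\<lambda>x. \<Sum>\<^sub>\<infinity>j\<in>I. \<eta> j x) \<in> borel_measurable borel"
    using countable_I \<eta> by (rule borel_measurable_infsum_real)
  have [measurable]: "\<eta> i \<in> borel_measurable borel" by (rule \<eta>[OF assms])
  have [measurable]: "closure D \<in> sets borel" by simp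
  show ?thesis
    unfolding partition_fun_def[abs_def] by measurable
qed

lemma partition_nonneg: "i \<in> I \<Longrightarrow> 0 \<le> \<psi> i x"
  by (simp add: partition_fun_def \<eta>_nonneg infsum_nonneg)

lemma partition_support: "i \<in> I \<Longrightarrow> x \<notin> ball (p i) (3 * \<rho> i) \<Longrightarrow> \<psi> i x = 0"
  by (simp add: partition_fun_def \<eta>_support)

text \<open>If the cutoffs were not summable at \<open>x\<close>, the junk value \<open>0\<close> of their sum would make
  every \<open>\<psi> i x\<close> vanish, so the finite overlap of the cover is not needed here.\<close>

lemma sum_partition_le_1: "(\<integral>\<^sup>+i. ennreal (\<psi> i x) \<partial>count_space \<Lambda>) \<le> 1"
proof -
  define S where "S = (\<Sum>\<^sub>\<infinity>j\<in>I. \<eta> j x)"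
  have S0: "0 \<le> S" unfolding S_def by (simp add: infsum_nonneg \<eta>_nonneg)
  have "(\<integral>\<^sup>+i. ennreal (\<psi> i x) \<partial>count_space \<Lambda>) \<le> (\<integral>\<^sup>+i. ennreal (\<psi> i x) \<partial>count_space I)"
    using \<Lambda>_subset
    by (auto simp: nn_integral_count_space_indicator indicator_def intro!: nn_integral_mono)
  also have "\<dots> \<le> 1"
  proof (cases "x \<in> closure D \<or> S = 0")
    case True
    then have "\<psi> i x = 0" for i by (auto simp: partition_fun_def S_def)
    then show ?thesis by simp
  next
    case False
    then have int: "integrable (count_space I) (\<lambda>j. \<eta> j x)"
      unfolding S_def infsum_eq_lebesgue_integral using not_integrable_integral_eq by blast
    have "(\<integral>\<^sup>+i. ennreal (\<psi> i x) \<partial>count_space I) = (\<integral>\<^sup>+i. ennreal (\<eta> i x / S) \<partial>count_space I)"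
      using False by (simp add: partition_fun_def S_def)
    also have "\<dots> = ennreal (\<integral>i. \<eta> i x / S \<partial>count_space I)"
      using int S0 by (intro nn_integral_eq_integral) (auto simp: \<eta>_nonneg AE_count_space)
    also have "(\<integral>i. \<eta> i x / S \<partial>count_space I) = S / S"
      by (simp add: S_def infsum_eq_lebesgue_integral)
    finally show ?thesis using False by simp
  qed
  finally show ?thesis .
qed

lemma partition_le_1:
  assumes "i \<in> \<Lambda>"
  shows "\<psi> i x \<le> 1"
proof -
  have "ennreal (\<psi> i x) \<le> (\<integral>\<^sup>+i. ennreal (\<psi> i x) \<partial>count_space \<Lambda>)"
    using assms by (rule nn_integral_ge_point)
  also note sum_partition_le_1
  finally show ?thesis by simp
qed

section \<open>The measure \<open>m0\<close> and truncation to \<open>D\<close>\<close>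

lemma m0_borel_measurable_iff:
  "u \<in> borel_measurable (m0 m D) \<longleftrightarrow> (\<lambda>x. indicator (closure D) x * u x) \<in> borel_measurable m"
  for u :: "'a \<Rightarrow> real"
  unfolding m0_def by (subst borel_measurable_restrict_space_iff) simp_all

lemma AE_m0_iff: "(AE x in m0 m D. P x) \<longleftrightarrow> (AE x in m. x \<in> D \<longrightarrow> P x)"
proof -
  have "(AE x in m0 m D. P x) \<longleftrightarrow> (AE x in density m (indicator D). x \<in> closure D \<longrightarrow> P x)"
    unfolding m0_def by (rule AE_restrict_space_iff) simp
  also have "\<dots> \<longleftrightarrow> (AE x in m. 0 < (indicator D x :: ennreal) \<longrightarrow> x \<in> closure D \<longrightarrow> P x)"
    by (rule AE_density) simp
  also have "\<dots> \<longleftrightarrow> (AE x in m. x \<in> D \<longrightarrow> P x)"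
    by (rule AE_cong) (use closure_subset[of D] in \<open>auto simp: indicator_def\<close>)
  finally show ?thesis .
qed

lemma nn_integral_m0_square:
  assumes u: "u \<in> borel_measurable (m0 m D)" and A: "A \<in> sets borel"
  shows "(\<integral>\<^sup>+x\<in>A. ennreal ((u x)\<^sup>2) \<partial>m0 m D) = (\<integral>\<^sup>+x\<in>A. ennreal ((cut u x)\<^sup>2) \<partial>m)"
proof -
  \<comment> \<open>Off the closure of \<open>D\<close> the values of \<open>u\<close> are
    arbitrary; this product is the \<open>m\<close>-measurable stand-in to which the density formula
    applies.\<close>
  let ?c = "\<lambda>x. indicator (closure D) x * u x"
  have [measurable]: "?c \<in> borel_measurable m" using u by (simp add: m0_borel_measurable_iff)
  have [measurable]: "A \<in> sets borel" by (rule A)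
  have "(\<integral>\<^sup>+x\<in>A. ennreal ((u x)\<^sup>2) \<partial>m0 m D) =
      (\<integral>\<^sup>+x. ennreal ((u x)\<^sup>2) * indicator A x * indicator (closure D) x \<partial>density m (indicator D))"
    unfolding m0_def by (rule nn_integral_restrict_space) simp
  also have "\<dots> = (\<integral>\<^sup>+x. ennreal ((?c x)\<^sup>2) * indicator A x \<partial>density m (indicator D))"
    by (intro nn_integral_cong) (simp add: indicator_def)
  also have "\<dots> = (\<integral>\<^sup>+x. indicator D x * (ennreal ((?c x)\<^sup>2) * indicator A x) \<partial>m)"
    by (rule nn_integral_density) simp_all
  also have "\<dots> = (\<integral>\<^sup>+x\<in>A. ennreal ((cut u x)\<^sup>2) \<partial>m)"
    using closure_subset[of D] by (intro nn_integral_cong) (auto simp: indicator_def cut_def)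
  finally show ?thesis .
qed

lemma L2_m0_D:
  assumes "u \<in> L2 (m0 m D)"
  shows "u \<in> borel_measurable (m0 m D)" "cut u \<in> borel_measurable m" "integrable m (\<lambda>x. (cut u x)\<^sup>2)"
proof -
  show u: "u \<in> borel_measurable (m0 m D)" using assms by (simp add: L2_def)
  then have [measurable]: "(\<lambda>x. indicator (closure D) x * u x) \<in> borel_measurable m"
    by (simp add: m0_borel_measurable_iff)
  have "cut u = (\<lambda>x. indicator D x * (indicator (closure D) x * u x))"
    using closure_subset[of D] by (auto simp: fun_eq_iff cut_def indicator_def)
  then show v [measurable]: "cut u \<in> borel_measurable m" by simp
  have "(\<integral>\<^sup>+x. ennreal ((cut u x)\<^sup>2) \<partial>m) = (\<integral>\<^sup>+x. ennreal ((u x)\<^sup>2) \<partial>m0 m D)"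
    using nn_integral_m0_square[OF u, of UNIV] by simp
  also have "\<dots> < \<infinity>"
    using assms by (simp add: L2_def integrable_iff_bounded)
  finally show "integrable m (\<lambda>x. (cut u x)\<^sup>2)"
    by (intro integrableI_nonneg) simp_all
qed

section \<open>The averages over the functions \<open>f i\<close>\<close>

lemma mean_eq: "mean i u = (\<integral>x. f i x * cut u x \<partial>m) / (\<integral>x. indicator D x * f i x \<partial>m)"
  by (simp add: weighted_mean_def set_lebesgue_integral_def cut_def mult_ac)

text \<open>Both factors are square integrable, and |ab| \<le> a^2 + b^2.\<close>

lemma integrable_f_cut:
  assumes i: "i \<in> \<Lambda>" and u: "u \<in> L2 (m0 m D)"
  shows "integrable m (\<lambda>x. f i x * cut u x)"
proof (rule Bochner_Integration.integrable_bound)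
  note [measurable] = f_measurable[OF i] L2_m0_D(2)[OF u]
  have "integrable m (\<lambda>x. (f i x)\<^sup>2)"
    using averaging i by (simp add: averaging_family_def L2_def)
  then show "integrable m (\<lambda>x. (f i x)\<^sup>2 + (cut u x)\<^sup>2)"
    using L2_m0_D(3)[OF u] by (rule Bochner_Integration.integrable_add)
  have "\<bar>a * b\<bar> \<le> a\<^sup>2 + b\<^sup>2" for a b :: real
    using sum_squares_bound[of "\<bar>a\<bar>" "\<bar>b\<bar>"] mult_nonneg_nonneg[of "\<bar>a\<bar>" "\<bar>b\<bar>"]
    unfolding abs_mult power2_abs by linarith
  then show "AE x in m. norm (f i x * cut u x) \<le> norm ((f i x)\<^sup>2 + (cut u x)\<^sup>2)"
    by simp
  show "(\<lambda>x. f i x * cut u x) \<in> borel_measurable m" by measurable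
qed

text \<open>Cauchy--Schwarz with weight \<open>f i\<close> on \<open>D\<close>. Keeping the total
  weight on the left, instead of dividing by it, makes the degenerate case trivial.\<close>

lemma mean_square_le:
  assumes i: "i \<in> \<Lambda>" and u: "u \<in> L2 (m0 m D)"
  shows "ennreal ((mean i u)\<^sup>2 * (\<integral>x. indicator D x * f i x \<partial>m)) \<le> (\<integral>\<^sup>+x. ennreal (f i x) * ennreal ((cut u x)\<^sup>2) \<partial>m)"
proof -
  note [measurable] = f_measurable[OF i] L2_m0_D(2)[OF u]
  define F where "F = (\<integral>x. indicator D x * f i x \<partial>m)"
  have nn: "AE x in m. 0 \<le> indicator D x * f i x"
    using f_bounds[OF i] by eventually_elim simp
  have intQ: "integrable m (\<lambda>x. f i x * (cut u x)\<^sup>2)"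
  proof (rule Bochner_Integration.integrable_bound[OF L2_m0_D(3)[OF u]])
    show "AE x in m. norm (f i x * (cut u x)\<^sup>2) \<le> norm ((cut u x)\<^sup>2)"
      using f_bounds[OF i] by eventually_elim (simp add: abs_mult mult_left_le_one_le)
    show "(\<lambda>x. f i x * (cut u x)\<^sup>2) \<in> borel_measurable m" by measurable
  qed
  have "(mean i u)\<^sup>2 * F \<le> (\<integral>x. f i x * (cut u x)\<^sup>2 \<partial>m)"
  proof (cases "F = 0")
    case True
    have "0 \<le> (\<integral>x. f i x * (cut u x)\<^sup>2 \<partial>m)"
      by (rule integral_nonneg_AE) (use f_bounds[OF i] in eventually_elim, simp)
    with True show ?thesis by simp
  next
    case False
    \<comment> \<open>A nonzero value rules out the default value of a non-integrable
      weight.\<close>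
    then have intF: "integrable m (\<lambda>x. indicator D x * f i x)"
      unfolding F_def using not_integrable_integral_eq by blast
    have F0: "F > 0"
      using False integral_nonneg_AE[OF nn] by (simp add: F_def)
    have eq: "indicator D x * f i x * cut u x = f i x * cut u x"
      "indicator D x * f i x * (cut u x)\<^sup>2 = f i x * (cut u x)\<^sup>2" for x
      by (simp_all add: cut_def indicator_def)
    have "(\<integral>x. f i x * cut u x \<partial>m)\<^sup>2 \<le> F * (\<integral>x. f i x * (cut u x)\<^sup>2 \<partial>m)"
      using weighted_Cauchy_Schwarz[OF intF _ _ nn, of "cut u"] integrable_f_cut[OF i u] intQ
      by (simp add: eq F_def)
    moreover have "(mean i u)\<^sup>2 * F = (\<integral>x. f i x * cut u x \<partial>m)\<^sup>2 / F"
      using False by (simp add: mean_eq F_def[symmetric] power2_eq_square)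
    ultimately show ?thesis using F0 by (simp add: divide_le_eq mult.commute)
  qed
  then have "ennreal ((mean i u)\<^sup>2 * F) \<le> ennreal (\<integral>x. f i x * (cut u x)\<^sup>2 \<partial>m)"
    by (rule ennreal_leI)
  also have "\<dots> = (\<integral>\<^sup>+x. ennreal (f i x * (cut u x)\<^sup>2) \<partial>m)"
    using intQ by (rule nn_integral_eq_integral[symmetric]) (use f_bounds[OF i] in eventually_elim, simp)
  also have "\<dots> = (\<integral>\<^sup>+x. ennreal (f i x) * ennreal ((cut u x)\<^sup>2) \<partial>m)"
    by (rule nn_integral_cong_AE) (use f_bounds[OF i] in eventually_elim, simp add: ennreal_mult)
  finally show ?thesis by (simp add: F_def)
qed

text \<open>\<open>\<psi> i\<close> is carried by the ball of radius \<open>3 * \<rho> i\<close>, so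
  this controls the contribution of one Whitney ball, uniformly in \<open>i\<close> and
  \<open>u\<close>.\<close>

lemma mean_square_emeasure_le:
  "\<exists>K>0. \<forall>i\<in>\<Lambda>. \<forall>u\<in>L2 (m0 m D).
     ennreal ((mean i u)\<^sup>2) * emeasure m (ball (p i) (3 * \<rho> i))
       \<le> ennreal K * (\<integral>\<^sup>+x. ennreal (f i x) * ennreal ((cut u x)\<^sup>2) \<partial>m)"
proof -
  obtain A where A: "A > 1" "\<And>y s. s > 0 \<Longrightarrow> emeasure m (ball y (2 * s)) \<le> ennreal A * emeasure m (ball y s)"
    using doubling unfolding volume_doubling_def by blast
  obtain B where B: "B > 1"
    "\<And>i. i \<in> \<Lambda> \<Longrightarrow> measure m (ball (p i) (\<rho> i)) / B \<le> (LINT x:D|m. f i x)"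
    using averaging unfolding averaging_family_def by blast
  show ?thesis
  \<comment> \<open>\<open>A\<^sup>2\<close> pays for two doublings, since
    \<open>3 * \<rho> i\<close> \<le> \<open>4 * \<rho> i\<close>; \<open>B\<close> comes from the
    lower bound on the integral of \<open>f i\<close> over \<open>D\<close>.\<close>
  proof (intro exI[of _ "A\<^sup>2 * B"] conjI ballI)
    show "A\<^sup>2 * B > 0" using A(1) B(1) by simp
    fix i u assume i: "i \<in> \<Lambda>" and u: "u \<in> L2 (m0 m D)"
    have \<rho>: "0 < \<rho> i" using i \<Lambda>_subset radius_pos by blast
    define F where "F = (\<integral>x. indicator D x * f i x \<partial>m)"
    define M where "M = measure m (ball (p i) (\<rho> i))"
    have "M / B \<le> F"
      using B(2)[OF i] by (simp add: M_def F_def set_lebesgue_integral_def)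
    then have MF: "M \<le> B * F" using B(1) by (simp add: field_simps)
    have "emeasure m (ball (p i) (3 * \<rho> i)) \<le> emeasure m (ball (p i) (2 * (2 * \<rho> i)))"
      using \<rho> by (intro emeasure_mono subset_ball) auto
    also have "\<dots> \<le> ennreal A * emeasure m (ball (p i) (2 * \<rho> i))"
      using \<rho> by (intro A) simp
    also have "\<dots> \<le> ennreal A * (ennreal A * emeasure m (ball (p i) (\<rho> i)))"
      using \<rho> by (intro mult_left_mono A) simp_all
    \<comment> \<open>Finiteness of balls matters here: \<open>measure\<close> would be 0 on a ball
      of infinite measure.\<close>
    also have "emeasure m (ball (p i) (\<rho> i)) = ennreal M"
      using emeasure_ball_finite[OF locally_compact radon doubling, of "p i" "\<rho> i"]
      by (simp add: M_def emeasure_eq_ennreal_measure less_top)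
    also have "ennreal A * (ennreal A * ennreal M) = ennreal (A\<^sup>2 * M)"
      using A(1) by (simp add: ennreal_mult' power2_eq_square mult.assoc)
    finally have "ennreal ((mean i u)\<^sup>2) * emeasure m (ball (p i) (3 * \<rho> i)) \<le> ennreal ((mean i u)\<^sup>2) * ennreal (A\<^sup>2 * M)"
      by (rule mult_left_mono) simp
    also have "\<dots> = ennreal ((mean i u)\<^sup>2 * (A\<^sup>2 * M))"
      by (simp add: ennreal_mult')
    also have "\<dots> \<le> ennreal ((mean i u)\<^sup>2 * (A\<^sup>2 * (B * F)))"
      by (intro ennreal_leI mult_left_mono MF) simp_all
    also have "(mean i u)\<^sup>2 * (A\<^sup>2 * (B * F)) = (A\<^sup>2 * B) * ((mean i u)\<^sup>2 * F)"
      by (simp add: mult_ac)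
    also have "ennreal \<dots> = ennreal (A\<^sup>2 * B) * ennreal ((mean i u)\<^sup>2 * F)"
      using B(1) by (intro ennreal_mult') simp
    also have "\<dots> \<le> ennreal (A\<^sup>2 * B) * (\<integral>\<^sup>+x. ennreal (f i x) * ennreal ((cut u x)\<^sup>2) \<partial>m)"
      using mean_square_le[OF i u] unfolding F_def by (rule mult_left_mono) simp
    finally show "ennreal ((mean i u)\<^sup>2) * emeasure m (ball (p i) (3 * \<rho> i))
        \<le> ennreal (A\<^sup>2 * B) * (\<integral>\<^sup>+x. ennreal (f i x) * ennreal ((cut u x)\<^sup>2) \<partial>m)" .
  qed
qed

section \<open>Summation over the Whitney cover\<close>

lemma sum_mean_square_measurable:
  "(\<lambda>x. \<integral>\<^sup>+i. ennreal (\<psi> i x * (mean i u)\<^sup>2) \<partial>count_space \<Lambda>) \<in> borel_measurable m"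
proof (rule borel_measurable_nn_integral_count_space[OF countable_\<Lambda>])
  fix i assume "i \<in> \<Lambda>"
  then have [measurable]: "\<psi> i \<in> borel_measurable borel"
    using \<Lambda>_subset by (intro partition_measurable) auto
  show "(\<lambda>x. ennreal (\<psi> i x * (mean i u)\<^sup>2)) \<in> borel_measurable m" by measurable
qed

text \<open>Tonelli moves the sum outside, the single-ball bound applies termwise, and Tonelli back
  lets \<Sum> f_i \<le> 1 absorb the sum. General \<open>S\<close> and \<open>S'\<close> serve both
  the local estimate, with two concentric balls, and the global one.\<close>

lemma sum_mean_square_bound:
  "\<exists>K>0. \<forall>u\<in>L2 (m0 m D). \<forall>S\<in>sets borel. \<forall>S'\<in>sets borel.
       (\<forall>i\<in>\<Lambda>. ball (p i) (3 * \<rho> i) \<inter> S \<noteq> {} \<longrightarrow> cball (p i) (9 * \<rho> i) \<subseteq> S') \<longrightarrow>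
       (\<integral>\<^sup>+x\<in>S. (\<integral>\<^sup>+i. ennreal (\<psi> i x * (mean i u)\<^sup>2) \<partial>count_space \<Lambda>) \<partial>m)
         \<le> ennreal K * (\<integral>\<^sup>+x\<in>S'. ennreal ((cut u x)\<^sup>2) \<partial>m)"
proof -
  obtain K where K: "K > 0" "\<And>i u. i \<in> \<Lambda> \<Longrightarrow> u \<in> L2 (m0 m D) \<Longrightarrow>
      ennreal ((mean i u)\<^sup>2) * emeasure m (ball (p i) (3 * \<rho> i))
        \<le> ennreal K * (\<integral>\<^sup>+x. ennreal (f i x) * ennreal ((cut u x)\<^sup>2) \<partial>m)"
    using mean_square_emeasure_le by blast
  show ?thesis
  proof (intro exI[of _ K] conjI ballI impI K(1))
    fix u S S'
    assume u: "u \<in> L2 (m0 m D)" and [measurable]: "S \<in> sets borel" "S' \<in> sets borel"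
      and "\<forall>i\<in>\<Lambda>. ball (p i) (3 * \<rho> i) \<inter> S \<noteq> {} \<longrightarrow> cball (p i) (9 * \<rho> i) \<subseteq> S'"
    then have SS': "cball (p i) (9 * \<rho> i) \<subseteq> S'" if "i \<in> \<Lambda>" "ball (p i) (3 * \<rho> i) \<inter> S \<noteq> {}" for i
      using that by blast
    note [measurable] = L2_m0_D(2)[OF u]
    have \<psi>_meas [measurable]: "i \<in> \<Lambda> \<Longrightarrow> \<psi> i \<in> borel_measurable borel" for i
      using \<Lambda>_subset by (intro partition_measurable) auto
    let ?g = "\<lambda>i x. ennreal (f i x) * ennreal ((cut u x)\<^sup>2) * indicator S' x"
    have local_bound: "(\<integral>\<^sup>+x. ennreal (\<psi> i x * (mean i u)\<^sup>2) * indicator S x \<partial>m) \<le> ennreal K * (\<integral>\<^sup>+x. ?g i x \<partial>m)"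
      if i: "i \<in> \<Lambda>" for i
    \<comment> \<open>An index whose enlarged ball misses \<open>S\<close> contributes nothing; for
      the others the enlarged support of \<open>f i\<close> lies in \<open>S'\<close>.\<close>
    proof (cases "ball (p i) (3 * \<rho> i) \<inter> S = {}")
      case True
      have "ennreal (\<psi> i x * (mean i u)\<^sup>2) * indicator S x = 0" for x
      proof (cases "x \<in> S")
        case True
        then have "\<psi> i x = 0"
          using i \<Lambda>_subset \<open>ball (p i) (3 * \<rho> i) \<inter> S = {}\<close> by (intro partition_support) auto
        then show ?thesis by simp
      qed simp
      then show ?thesis by (simp only: nn_integral_const) simp
    next
      case False
      have [measurable]: "f i \<in> borel_measurable borel" using i by measurable
      have "(\<integral>\<^sup>+x. ennreal (\<psi> i x * (mean i u)\<^sup>2) * indicator S x \<partial>m)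
          \<le> (\<integral>\<^sup>+x. ennreal ((mean i u)\<^sup>2) * indicator (ball (p i) (3 * \<rho> i)) x \<partial>m)"
      proof (rule nn_integral_mono)
        fix x
        have "\<psi> i x * (mean i u)\<^sup>2 \<le> (mean i u)\<^sup>2"
          using partition_le_1[OF i] partition_nonneg[of i x] i \<Lambda>_subset by (intro mult_left_le_one_le) auto
        moreover have "\<psi> i x = 0" if "x \<notin> ball (p i) (3 * \<rho> i)"
          using that i \<Lambda>_subset by (intro partition_support) auto
        ultimately show "ennreal (\<psi> i x * (mean i u)\<^sup>2) * indicator S x
            \<le> ennreal ((mean i u)\<^sup>2) * indicator (ball (p i) (3 * \<rho> i)) x"
          by (cases "x \<in> ball (p i) (3 * \<rho> i)") (simp_all add: indicator_def ennreal_leI)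
      qed
      also have "\<dots> = ennreal ((mean i u)\<^sup>2) * emeasure m (ball (p i) (3 * \<rho> i))"
        by (rule nn_integral_cmult_indicator) simp
      also have "\<dots> \<le> ennreal K * (\<integral>\<^sup>+x. ennreal (f i x) * ennreal ((cut u x)\<^sup>2) \<partial>m)"
        using i u by (rule K(2))
      \<comment> \<open>Restricting to \<open>S'\<close> loses nothing, since \<open>f i\<close>
        vanishes almost everywhere off the ball of radius \<open>9 * \<rho> i\<close>.\<close>
      also have "(\<integral>\<^sup>+x. ennreal (f i x) * ennreal ((cut u x)\<^sup>2) \<partial>m) = (\<integral>\<^sup>+x. ?g i x \<partial>m)"
      proof (rule nn_integral_cong_AE)
        show "AE x in m. ennreal (f i x) * ennreal ((cut u x)\<^sup>2) = ?g i x"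
          using f_support[OF i]
        proof eventually_elim
          case (elim x)
          then show ?case using SS'[OF i False] by (cases "x \<in> S'") auto
        qed
      qed
      finally show ?thesis .
    qed
    have "(\<integral>\<^sup>+x\<in>S. (\<integral>\<^sup>+i. ennreal (\<psi> i x * (mean i u)\<^sup>2) \<partial>count_space \<Lambda>) \<partial>m)
        = (\<integral>\<^sup>+x. (\<integral>\<^sup>+i. ennreal (\<psi> i x * (mean i u)\<^sup>2) * indicator S x \<partial>count_space \<Lambda>) \<partial>m)"
      by (intro nn_integral_cong nn_integral_multc[symmetric]) simp
    also have "\<dots> = (\<integral>\<^sup>+i. (\<integral>\<^sup>+x. ennreal (\<psi> i x * (mean i u)\<^sup>2) * indicator S x \<partial>m) \<partial>count_space \<Lambda>)"
      using countable_\<Lambda> by (rule nn_integral_count_space_nn_integral) measurable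
    also have "\<dots> \<le> (\<integral>\<^sup>+i. ennreal K * (\<integral>\<^sup>+x. ?g i x \<partial>m) \<partial>count_space \<Lambda>)"
      by (intro nn_integral_mono local_bound) simp
    also have "\<dots> = ennreal K * (\<integral>\<^sup>+i. (\<integral>\<^sup>+x. ?g i x \<partial>m) \<partial>count_space \<Lambda>)"
      by (rule nn_integral_cmult) simp
    also have "(\<integral>\<^sup>+i. (\<integral>\<^sup>+x. ?g i x \<partial>m) \<partial>count_space \<Lambda>) = (\<integral>\<^sup>+x. (\<integral>\<^sup>+i. ?g i x \<partial>count_space \<Lambda>) \<partial>m)"
      using countable_\<Lambda> by (rule nn_integral_count_space_nn_integral[symmetric]) measurable
    also have "\<dots> \<le> (\<integral>\<^sup>+x\<in>S'. ennreal ((cut u x)\<^sup>2) \<partial>m)"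
    proof (rule nn_integral_mono_AE)
      show "AE x in m. (\<integral>\<^sup>+i. ?g i x \<partial>count_space \<Lambda>) \<le> ennreal ((cut u x)\<^sup>2) * indicator S' x"
        using sum_f_le_1
      proof eventually_elim
        case (elim x)
        have "(\<integral>\<^sup>+i. ?g i x \<partial>count_space \<Lambda>)
            = (\<integral>\<^sup>+i. ennreal (f i x) \<partial>count_space \<Lambda>) * (ennreal ((cut u x)\<^sup>2) * indicator S' x)"
          by (simp add: nn_integral_multc mult.assoc)
        also have "\<dots> \<le> 1 * (ennreal ((cut u x)\<^sup>2) * indicator S' x)"
          using elim by (rule mult_right_mono) simp
        finally show ?case by simp
      qed
    qed
    finally show "(\<integral>\<^sup>+x\<in>S. (\<integral>\<^sup>+i. ennreal (\<psi> i x * (mean i u)\<^sup>2) \<partial>count_space \<Lambda>) \<partial>m)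
        \<le> ennreal K * (\<integral>\<^sup>+x\<in>S'. ennreal ((cut u x)\<^sup>2) \<partial>m)"
      by (simp add: mult_left_mono)
  qed
qed

section \<open>Measurability and bounds of the extension\<close>

lemma Ext_eq:
  "Ext u x = (if x \<in> closure D then u x else (\<integral>i. \<psi> i x * mean i u \<partial>count_space \<Lambda>))"
  by (simp add: extension_operator_def infsum_eq_lebesgue_integral mult.commute)

lemma Ext_measurable:
  assumes u: "u \<in> L2 (m0 m D)"
  shows "Ext u \<in> borel_measurable m"
proof -
  have [measurable]: "(\<lambda>x. indicator (closure D) x * u x) \<in> borel_measurable m"
    using L2_m0_D(1)[OF u] by (simp add: m0_borel_measurable_iff)
  have [measurable]: "(\<lambda>x. \<Sum>\<^sub>\<infinity>i\<in>\<Lambda>. mean i u * \<psi> i x) \<in> borel_measurable m"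
  proof (rule borel_measurable_infsum_real[OF countable_\<Lambda>])
    fix i assume "i \<in> \<Lambda>"
    then have [measurable]: "\<psi> i \<in> borel_measurable borel"
      using \<Lambda>_subset by (intro partition_measurable) auto
    show "(\<lambda>x. mean i u * \<psi> i x) \<in> borel_measurable m" by measurable
  qed
  have [measurable]: "closure D \<in> sets m" by simp
  \<comment> \<open>On the first branch the indicator is 1, so inserting it changes no value but
    yields a measurable function.\<close>
  have "Ext u = (\<lambda>x. if x \<in> closure D then indicator (closure D) x * u x
      else (\<Sum>\<^sub>\<infinity>i\<in>\<Lambda>. mean i u * \<psi> i x))"
    by (auto simp: fun_eq_iff extension_operator_def)
  also have "\<dots> \<in> borel_measurable m" by measurable
  finally show ?thesis .
qed

lemma Ext_bound:
  "\<exists>K>0. \<forall>u\<in>L2 (m0 m D). \<forall>S\<in>sets borel. \<forall>S'\<in>sets borel. S \<subseteq> S' \<longrightarrow>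
       (\<forall>i\<in>\<Lambda>. ball (p i) (3 * \<rho> i) \<inter> S \<noteq> {} \<longrightarrow> cball (p i) (9 * \<rho> i) \<subseteq> S') \<longrightarrow>
       (\<integral>\<^sup>+x\<in>S. ennreal (\<bar>Ext u x\<bar>\<^sup>2) \<partial>m) \<le> ennreal K * (\<integral>\<^sup>+x\<in>S'. ennreal ((cut u x)\<^sup>2) \<partial>m)"
proof -
  obtain K where K: "K > 0" and bound: "\<forall>u\<in>L2 (m0 m D). \<forall>S\<in>sets borel. \<forall>S'\<in>sets borel.
       (\<forall>i\<in>\<Lambda>. ball (p i) (3 * \<rho> i) \<inter> S \<noteq> {} \<longrightarrow> cball (p i) (9 * \<rho> i) \<subseteq> S') \<longrightarrow>
       (\<integral>\<^sup>+x\<in>S. (\<integral>\<^sup>+i. ennreal (\<psi> i x * (mean i u)\<^sup>2) \<partial>count_space \<Lambda>) \<partial>m)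
         \<le> ennreal K * (\<integral>\<^sup>+x\<in>S'. ennreal ((cut u x)\<^sup>2) \<partial>m)"
    using sum_mean_square_bound by blast
  show ?thesis
  \<comment> \<open>The 1 accounts for the closure of \<open>D\<close>, where the extension is
    \<open>u\<close> and the boundary is null; \<open>K\<close> accounts for the complement, through
    Jensen.\<close>
  proof (intro exI[of _ "1 + K"] conjI ballI impI)
    show "1 + K > 0" using K by simp
    fix u S S'
    assume u: "u \<in> L2 (m0 m D)" and S [measurable]: "S \<in> sets borel" "S' \<in> sets borel" and sub: "S \<subseteq> S'"
      and SS': "\<forall>i\<in>\<Lambda>. ball (p i) (3 * \<rho> i) \<inter> S \<noteq> {} \<longrightarrow> cball (p i) (9 * \<rho> i) \<subseteq> S'"
    note [measurable] = L2_m0_D(2)[OF u]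
    let ?Q = "\<lambda>x. \<integral>\<^sup>+i. ennreal (\<psi> i x * (mean i u)\<^sup>2) \<partial>count_space \<Lambda>"
    let ?R = "\<integral>\<^sup>+x\<in>S'. ennreal ((cut u x)\<^sup>2) \<partial>m"
    note [measurable] = sum_mean_square_measurable[of u]
    have "(\<integral>\<^sup>+x\<in>S. ennreal (\<bar>Ext u x\<bar>\<^sup>2) \<partial>m)
        \<le> (\<integral>\<^sup>+x. ennreal ((cut u x)\<^sup>2) * indicator S' x + ?Q x * indicator S x \<partial>m)"
    proof (rule nn_integral_mono_AE)
      show "AE x in m. ennreal (\<bar>Ext u x\<bar>\<^sup>2) * indicator S x
          \<le> ennreal ((cut u x)\<^sup>2) * indicator S' x + ?Q x * indicator S x"
        using boundary_AE
      proof eventually_elim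
        case (elim x)
        have "ennreal (\<bar>Ext u x\<bar>\<^sup>2) \<le> ennreal ((cut u x)\<^sup>2) + ?Q x"
        proof (cases "x \<in> closure D")
          case True
          with elim have "\<bar>Ext u x\<bar>\<^sup>2 = (cut u x)\<^sup>2" by (simp add: Ext_eq cut_def)
          then show ?thesis by simp
        next
          case False
          have "ennreal ((\<integral>i. \<psi> i x * mean i u \<partial>count_space \<Lambda>)\<^sup>2) \<le> ?Q x"
            using \<Lambda>_subset sum_partition_le_1
            by (intro subprobability_Jensen_square) (auto intro: partition_nonneg)
          then show ?thesis using False by (simp add: Ext_eq add_increasing)
        qed
        then show ?case using sub by (auto simp: indicator_def)
      qed
    qed
    also have "\<dots> = ?R + (\<integral>\<^sup>+x\<in>S. ?Q x \<partial>m)"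
      by (rule nn_integral_add) measurable
    also have "\<dots> \<le> ?R + ennreal K * ?R"
      using bound u S SS' by (intro add_left_mono) blast
    also have "\<dots> = ennreal (1 + K) * ?R"
      using K by (simp add: distrib_right)
    finally show "(\<integral>\<^sup>+x\<in>S. ennreal (\<bar>Ext u x\<bar>\<^sup>2) \<partial>m) \<le> ennreal (1 + K) * ?R" .
  qed
qed

text \<open>The origin of the factor 7: 5\<rho> < 3\<rho> + r gives 2\<rho> < r, so points of the
  large ball are within (3\<rho> + r) + 9\<rho> < 7r of \<open>x0\<close>.\<close>

lemma support_ball_subset:
  assumes i: "i \<in> \<Lambda>" and x0: "x0 \<in> closure D" and meet: "ball (p i) (3 * \<rho> i) \<inter> ball x0 r \<noteq> {}"
  shows "cball (p i) (9 * \<rho> i) \<subseteq> ball x0 (7 * r)"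
proof
  fix y assume "y \<in> cball (p i) (9 * \<rho> i)"
  moreover obtain x where x: "dist (p i) x < 3 * \<rho> i" "dist x0 x < r" using meet by auto
  moreover have "5 * \<rho> i \<le> dist (p i) x0"
    using whitney i \<Lambda>_subset infdist_le[OF x0, of "p i"] by (auto simp: whitney_cover_def)
  moreover have "dist (p i) x0 \<le> dist (p i) x + dist x0 x" by (rule dist_triangle2)
  moreover have "dist x0 y \<le> dist (p i) x0 + dist (p i) y" by (rule dist_triangle3)
  ultimately show "y \<in> ball x0 (7 * r)" by simp
qed

section \<open>Summability almost everywhere and linearity\<close>

lemma AE_integrable_mean_partition:
  assumes u: "u \<in> L2 (m0 m D)"
  shows "AE x in m. integrable (count_space \<Lambda>) (\<lambda>i. \<psi> i x * mean i u)"
proof -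
  let ?Q = "\<lambda>x. \<integral>\<^sup>+i. ennreal (\<psi> i x * (mean i u)\<^sup>2) \<partial>count_space \<Lambda>"
  note [measurable] = L2_m0_D(2)[OF u]
  obtain K where "\<forall>u\<in>L2 (m0 m D). \<forall>S\<in>sets borel. \<forall>S'\<in>sets borel.
       (\<forall>i\<in>\<Lambda>. ball (p i) (3 * \<rho> i) \<inter> S \<noteq> {} \<longrightarrow> cball (p i) (9 * \<rho> i) \<subseteq> S') \<longrightarrow>
       (\<integral>\<^sup>+x\<in>S. (\<integral>\<^sup>+i. ennreal (\<psi> i x * (mean i u)\<^sup>2) \<partial>count_space \<Lambda>) \<partial>m)
         \<le> ennreal K * (\<integral>\<^sup>+x\<in>S'. ennreal ((cut u x)\<^sup>2) \<partial>m)"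
    using sum_mean_square_bound by blast
  \<comment> \<open>On the whole space the locality condition is trivial; the weighted sum of
    squares then has finite integral and is finite almost everywhere.\<close>
  from bspec[OF bspec[OF bspec[OF this u], of UNIV], of UNIV]
  have "(\<integral>\<^sup>+x\<in>UNIV. ?Q x \<partial>m) \<le> ennreal K * (\<integral>\<^sup>+x\<in>UNIV. ennreal ((cut u x)\<^sup>2) \<partial>m)"
    by simp
  moreover have "(\<integral>\<^sup>+x. ennreal ((cut u x)\<^sup>2) \<partial>m) < \<infinity>"
    using L2_m0_D(3)[OF u] by (simp add: integrable_iff_bounded)
  ultimately have "(\<integral>\<^sup>+x. ?Q x \<partial>m) \<noteq> \<infinity>"
    by (auto simp: ennreal_mult_eq_top_iff top_unique)
  then have "AE x in m. ?Q x \<noteq> \<infinity>"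
    using sum_mean_square_measurable by (intro nn_integral_noteq_infinite)
  then show ?thesis
  proof eventually_elim
    case (elim x)
    have nn: "0 \<le> \<psi> i x" if "i \<in> \<Lambda>" for i
      using that \<Lambda>_subset by (intro partition_nonneg) auto
    show ?case
    \<comment> \<open>Total weight at most 1 and summable squares give summable first powers. This
      secures additivity, which could fail if one of the sums took its default value.\<close>
    proof (rule integrable_weighted_of_square)
      show "integrable (count_space \<Lambda>) (\<lambda>i. \<psi> i x)"
        using sum_partition_le_1[of x] nn
        by (intro integrableI_nonneg) (auto simp: AE_count_space intro: le_less_trans)
      show "integrable (count_space \<Lambda>) (\<lambda>i. \<psi> i x * (mean i u)\<^sup>2)"
        using elim nn by (intro integrableI_nonneg) (auto simp: AE_count_space less_top)
    qed (auto simp: AE_count_space nn)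
  qed
qed

lemma mean_cong_AE:
  assumes i: "i \<in> \<Lambda>" and u: "u \<in> L2 (m0 m D)" and v: "v \<in> L2 (m0 m D)"
    and eq: "AE x in m0 m D. u x = v x"
  shows "mean i u = mean i v"
proof -
  note [measurable] = f_measurable[OF i] L2_m0_D(2)[OF u] L2_m0_D(2)[OF v]
  have "AE x in m. f i x * cut u x = f i x * cut v x"
    using eq[unfolded AE_m0_iff] by eventually_elim (simp add: cut_def indicator_def)
  then have "(\<integral>x. f i x * cut u x \<partial>m) = (\<integral>x. f i x * cut v x \<partial>m)"
    by (intro integral_cong_AE) simp_all
  then show ?thesis by (simp add: mean_eq)
qed

lemma mean_linear:
  assumes i: "i \<in> \<Lambda>" and u: "u \<in> L2 (m0 m D)" and v: "v \<in> L2 (m0 m D)"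
  shows "mean i (\<lambda>y. a * u y + b * v y) = a * mean i u + b * mean i v"
proof -
  have "f i x * cut (\<lambda>y. a * u y + b * v y) x = a * (f i x * cut u x) + b * (f i x * cut v x)" for x
    by (simp add: cut_def algebra_simps)
  then show ?thesis
    using integrable_f_cut[OF i u] integrable_f_cut[OF i v] by (simp add: mean_eq add_divide_distrib)
qed

lemma nn_integral_m0_square_D:
  assumes u: "u \<in> L2 (m0 m D)" and A: "A \<in> sets borel"
  shows "(\<integral>\<^sup>+x\<in>A \<inter> D. ennreal ((u x)\<^sup>2) \<partial>m0 m D) = (\<integral>\<^sup>+x\<in>A. ennreal ((cut u x)\<^sup>2) \<partial>m)"
proof -
  have "(\<integral>\<^sup>+x\<in>A \<inter> D. ennreal ((u x)\<^sup>2) \<partial>m0 m D) = (\<integral>\<^sup>+x\<in>A \<inter> D. ennreal ((cut u x)\<^sup>2) \<partial>m)"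
    using L2_m0_D(1)[OF u] A by (intro nn_integral_m0_square) auto
  also have "\<dots> = (\<integral>\<^sup>+x\<in>A. ennreal ((cut u x)\<^sup>2) \<partial>m)"
    by (intro nn_integral_cong) (simp add: cut_def indicator_def)
  finally show ?thesis .
qed

text \<open>One constant serves both estimates: the general bound is taken for the balls of radii
  \<open>r\<close> and \<open>7 * r\<close>, and for the whole space twice.\<close>

lemma Ext_L2_bounds:
  "\<exists>K>0. (\<forall>u\<in>L2 (m0 m D). \<forall>x0\<in>closure D. \<forall>r>0.
         (\<integral>\<^sup>+x\<in>ball x0 r. ennreal (\<bar>Ext u x\<bar>\<^sup>2) \<partial>m)
           \<le> ennreal K * (\<integral>\<^sup>+x\<in>ball x0 (7 * r) \<inter> D. ennreal ((u x)\<^sup>2) \<partial>m0 m D))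
    \<and> (\<forall>u\<in>L2 (m0 m D).
         (\<integral>\<^sup>+x. ennreal (\<bar>Ext u x\<bar>\<^sup>2) \<partial>m) \<le> ennreal K * (\<integral>\<^sup>+x\<in>D. ennreal ((u x)\<^sup>2) \<partial>m0 m D))"
proof -
  obtain K where K: "K > 0" and bound:
      "\<forall>u\<in>L2 (m0 m D). \<forall>S\<in>sets borel. \<forall>S'\<in>sets borel. S \<subseteq> S' \<longrightarrow>
       (\<forall>i\<in>\<Lambda>. ball (p i) (3 * \<rho> i) \<inter> S \<noteq> {} \<longrightarrow> cball (p i) (9 * \<rho> i) \<subseteq> S') \<longrightarrow>
       (\<integral>\<^sup>+x\<in>S. ennreal (\<bar>Ext u x\<bar>\<^sup>2) \<partial>m) \<le> ennreal K * (\<integral>\<^sup>+x\<in>S'. ennreal ((cut u x)\<^sup>2) \<partial>m)"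
    using Ext_bound by (elim exE conjE) (rule that)
  show ?thesis
  proof (intro exI[of _ K] conjI ballI allI impI K)
    fix u x0 and r :: real assume u: "u \<in> L2 (m0 m D)" and x0: "x0 \<in> closure D" and r: "r > 0"
    have "\<forall>i\<in>\<Lambda>. ball (p i) (3 * \<rho> i) \<inter> ball x0 r \<noteq> {} \<longrightarrow> cball (p i) (9 * \<rho> i) \<subseteq> ball x0 (7 * r)"
      using support_ball_subset[OF _ x0] by simp
    moreover have "ball x0 r \<subseteq> ball x0 (7 * r)" using r by (intro subset_ball) simp
    ultimately have "(\<integral>\<^sup>+x\<in>ball x0 r. ennreal (\<bar>Ext u x\<bar>\<^sup>2) \<partial>m)
        \<le> ennreal K * (\<integral>\<^sup>+x\<in>ball x0 (7 * r). ennreal ((cut u x)\<^sup>2) \<partial>m)"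
      using bspec[OF bspec[OF bspec[OF bound u], of "ball x0 r"], of "ball x0 (7 * r)"] by simp
    then show "(\<integral>\<^sup>+x\<in>ball x0 r. ennreal (\<bar>Ext u x\<bar>\<^sup>2) \<partial>m)
        \<le> ennreal K * (\<integral>\<^sup>+x\<in>ball x0 (7 * r) \<inter> D. ennreal ((u x)\<^sup>2) \<partial>m0 m D)"
      using nn_integral_m0_square_D[OF u, of "ball x0 (7 * r)"] by simp
  next
    fix u assume u: "u \<in> L2 (m0 m D)"
    show "(\<integral>\<^sup>+x. ennreal (\<bar>Ext u x\<bar>\<^sup>2) \<partial>m) \<le> ennreal K * (\<integral>\<^sup>+x\<in>D. ennreal ((u x)\<^sup>2) \<partial>m0 m D)"
      using bspec[OF bspec[OF bspec[OF bound u], of UNIV], of UNIV] nn_integral_m0_square_D[OF u, of UNIV]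
      by simp
  qed
qed

lemma Ext_L2_linear: "L2_linear_operator (m0 m D) m Ext"
  unfolding L2_linear_operator_def
proof (intro conjI ballI allI impI)
  fix u assume u: "u \<in> L2 (m0 m D)"
  note [measurable] = Ext_measurable[OF u]
  obtain K where "(\<integral>\<^sup>+x. ennreal (\<bar>Ext u x\<bar>\<^sup>2) \<partial>m) \<le> ennreal K * (\<integral>\<^sup>+x\<in>D. ennreal ((u x)\<^sup>2) \<partial>m0 m D)"
    using Ext_L2_bounds u by meson
  also have "(\<integral>\<^sup>+x\<in>D. ennreal ((u x)\<^sup>2) \<partial>m0 m D) = (\<integral>\<^sup>+x. ennreal ((cut u x)\<^sup>2) \<partial>m)"
    using nn_integral_m0_square_D[OF u, of UNIV] by simp
  also have "ennreal K * \<dots> < \<infinity>"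
    using L2_m0_D(3)[OF u] by (simp add: integrable_iff_bounded ennreal_mult_less_top)
  finally have "integrable m (\<lambda>x. (Ext u x)\<^sup>2)"
    by (intro integrableI_nonneg) simp_all
  then show "Ext u \<in> L2 m" by (simp add: L2_def Ext_measurable[OF u])
next
  fix u v assume uv: "u \<in> L2 (m0 m D)" "v \<in> L2 (m0 m D)" and eq: "AE x in m0 m D. u x = v x"
  \<comment> \<open>The averages agree exactly, so the extensions coincide at every point off the
    closure of \<open>D\<close>; exceptional points can only lie in the closure.\<close>
  have "mean i u = mean i v" if "i \<in> \<Lambda>" for i using that uv eq by (rule mean_cong_AE)
  then have out: "(\<integral>i. \<psi> i x * mean i u \<partial>count_space \<Lambda>) = (\<integral>i. \<psi> i x * mean i v \<partial>count_space \<Lambda>)" for x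
    by (intro Bochner_Integration.integral_cong) simp_all
  show "AE x in m. Ext u x = Ext v x"
    using boundary_AE eq[unfolded AE_m0_iff] by eventually_elim (simp add: Ext_eq out)
next
  fix u v and a b :: real assume uv: "u \<in> L2 (m0 m D)" "v \<in> L2 (m0 m D)"
  show "AE x in m. Ext (\<lambda>y. a * u y + b * v y) x = a * Ext u x + b * Ext v x"
    using AE_integrable_mean_partition[OF uv(1)] AE_integrable_mean_partition[OF uv(2)]
  proof eventually_elim
    case (elim x)
    have "(\<integral>i. \<psi> i x * mean i (\<lambda>y. a * u y + b * v y) \<partial>count_space \<Lambda>)
        = (\<integral>i. a * (\<psi> i x * mean i u) + b * (\<psi> i x * mean i v) \<partial>count_space \<Lambda>)"
      by (rule Bochner_Integration.integral_cong) (simp_all add: mean_linear uv algebra_simps)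
    also have "\<dots> = a * (\<integral>i. \<psi> i x * mean i u \<partial>count_space \<Lambda>) + b * (\<integral>i. \<psi> i x * mean i v \<partial>count_space \<Lambda>)"
      using elim by simp
    finally show ?case by (simp add: Ext_eq)
  qed
qed

end

section \<open>The extension operator of the jump-type Dirichlet space\<close>

theorem proposition3p7:
  fixes m :: "'a::{metric_space, second_countable_topology} measure"
    and J :: "'a \<Rightarrow> 'a \<Rightarrow> ennreal"
    and \<E> :: "('a \<Rightarrow> real) \<Rightarrow> ('a \<Rightarrow> real) \<Rightarrow> real"
    and \<F> :: "('a \<Rightarrow> real) set"
    and \<phi> :: "real \<Rightarrow> real"
    and D :: "'a set"
    and I \<Lambda> :: "'i set"
    and p :: "'i \<Rightarrow> 'a"
    and \<rho> :: "'i \<Rightarrow> real"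
    and f \<eta> \<psi> :: "'i \<Rightarrow> 'a \<Rightarrow> real"
    and Ext :: "('a \<Rightarrow> real) \<Rightarrow> 'a \<Rightarrow> real"
  assumes "locally_compact_space (euclidean :: 'a topology)"
    and "radon_measure m" and "full_support m"
    and "(\<lambda>(x, y). J x y) \<in> borel_measurable (m \<Otimes>\<^sub>M m)"
    and "\<E> = jump_form m J" and "\<F> = jump_domain m J"
    and "regular_dirichlet_form m \<E> \<F>"
    and "scale_function \<phi>"
    and "volume_doubling m"
    and "cap_upper m \<E> \<F> \<phi>"
    and "open D" and "ahlfors_regular m D" and "closure D \<subset> UNIV"
    and "whitney_cover D I p \<rho>"
    and "\<Lambda> = small_indices D I \<rho>"
    and "averaging_family m D \<Lambda> p \<rho> f"
    and "cutoff_family m \<E> \<F> \<phi> I p \<rho> \<eta>"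
    and "\<psi> = partition_fun D I \<eta>"
    and "Ext = extension_operator m D \<Lambda> f \<psi>"
  shows "\<exists>C>0.
      (\<forall>u\<in>L2 (m0 m D). \<forall>x0\<in>closure D. \<forall>r>0.
         (\<integral>\<^sup>+x\<in>ball x0 r. ennreal (\<bar>Ext u x\<bar>\<^sup>2) \<partial>m)
           \<le> ennreal C * (\<integral>\<^sup>+x\<in>ball x0 (7 * r) \<inter> D. ennreal ((u x)\<^sup>2) \<partial>m0 m D))
    \<and> L2_linear_operator (m0 m D) m Ext
    \<and> (\<forall>u\<in>L2 (m0 m D). \<forall>x\<in>closure D. Ext u x = u x)
    \<and> (\<forall>u\<in>L2 (m0 m D).
         (\<integral>\<^sup>+x. ennreal (\<bar>Ext u x\<bar>\<^sup>2) \<partial>m) \<le> ennreal C * (\<integral>\<^sup>+x\<in>D. ennreal ((u x)\<^sup>2) \<partial>m0 m D))"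
proof -
  \<comment> \<open>Membership in the form domain makes the cutoffs measurable; their pointwise
    constraints supply sign and support.\<close>
  interpret W: whitney_extension m D I \<Lambda> p \<rho> f \<eta>
  proof
    show "\<Lambda> \<subseteq> I" using assms(15) by (auto simp: small_indices_def)
    show "\<eta> i \<in> borel_measurable m" if "i \<in> I" for i
      using assms(6,17) that by (auto simp: cutoff_family_def jump_domain_def L2_def)
    show "0 \<le> \<eta> i x" if "i \<in> I" for i x
      using assms(17) that by (simp add: cutoff_family_def)
    show "\<eta> i x = 0" if "i \<in> I" "x \<notin> ball (p i) (3 * \<rho> i)" for i x
      using assms(17) that unfolding cutoff_family_def by (meson ComplI)
  qed (use assms in simp_all)
  have Ext: "Ext = extension_operator m D \<Lambda> f (partition_fun D I \<eta>)"
    using assms(18,19) by simp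
  have "\<forall>u\<in>L2 (m0 m D). \<forall>x\<in>closure D. Ext u x = u x"
    by (simp add: Ext extension_operator_def)
  with W.Ext_L2_bounds W.Ext_L2_linear show ?thesis
    unfolding Ext[symmetric] by (elim exE conjE) (intro exI conjI)
qed

end
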